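(* Let $n\geq 3$ and let $m$ be an integer with $1\leq m<n$ and $m\equiv n-1 \pmod 8$. Then the set of primitive characteristic vectors of norm $-m$ in the lattice $\mathrm{I}_{1,n}$ is non-empty and forms exactly one orbit under $\mathrm{Aut}(\mathrm{I}_{1,n})$.
   Context: $\mathrm{I}_{1,n}$ denotes the odd unimodular lattice of signature $(1,n)$: the group $\mathbb{Z}^{n+1}$, with vectors written $u=(u^0;u^1,\ldots,u^n)$, and bilinear form $u\cdot v = u^0v^0-\sum_{i=1}^n u^iv^i$. The norm of $u$ is $u^2=u\cdot u$. $\mathrm{Aut}(\mathrm{I}_{1,n})$ is the group of all $\mathbb{Z}$-linear automorphisms of the lattice preserving the bilinear form. A vector $u$ in a lattice $\Gamma$ is primitive if there is no integer $k>1$ with $u\in k\Gamma$; it is characteristic if $u\cdot x\equiv x\cdot x \pmod 2$ for all $x\in\Gamma$. *)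

theory Defs
  imports "Jordan_Normal_Form.Matrix" "HOL-Algebra.Group_Action" "HOL-Number_Theory.Cong"
begin

text \<open>The coordinates \<open>u\<^sup>0, u\<^sup>1, \<dots>, u\<^sup>n\<close> of a vector of \<open>I\<^sub>1\<^sub>,\<^sub>n\<close> are
  \<open>u $ 0, u $ 1, \<dots>, u $ n\<close>, so the vectors have dimension \<open>Suc n\<close>.\<close>

definition I_lattice :: "nat \<Rightarrow> int vec set" where
  "I_lattice n = carrier_vec (Suc n)"

definition I_form :: "nat \<Rightarrow> int vec \<Rightarrow> int vec \<Rightarrow> int" where
  "I_form n u v = u $ 0 * v $ 0 - (\<Sum>i = 1..n. u $ i * v $ i)"

definition I_norm :: "nat \<Rightarrow> int vec \<Rightarrow> int" where
  "I_norm n u = I_form n u u"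

definition primitive_vec :: "nat \<Rightarrow> int vec \<Rightarrow> bool" where
  "primitive_vec n u \<longleftrightarrow>
     u \<in> I_lattice n \<and> \<not> (\<exists>k::int. k > 1 \<and> u \<in> (\<lambda>v. k \<cdot>\<^sub>v v) ` I_lattice n)"

definition characteristic_vec :: "nat \<Rightarrow> int vec \<Rightarrow> bool" where
  "characteristic_vec n u \<longleftrightarrow>
     u \<in> I_lattice n \<and> (\<forall>x\<in>I_lattice n. [I_form n u x = I_form n x x] (mod 2))"

text \<open>Automorphisms are extensional functions (undefined off the lattice), as required by
  \<^const>\<open>Bij\<close>; composition is that of \<^const>\<open>BijGroup\<close>.\<close>

definition I_automorphisms :: "nat \<Rightarrow> (int vec \<Rightarrow> int vec) set" where
  "I_automorphisms n = {f \<in> Bij (I_lattice n).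
     (\<forall>u\<in>I_lattice n. \<forall>v\<in>I_lattice n. f (u + v) = f u + f v) \<and>
     (\<forall>k. \<forall>u\<in>I_lattice n. f (k \<cdot>\<^sub>v u) = k \<cdot>\<^sub>v f u) \<and>
     (\<forall>u\<in>I_lattice n. \<forall>v\<in>I_lattice n. I_form n (f u) (f v) = I_form n u v)}"

definition Aut_I :: "nat \<Rightarrow> (int vec \<Rightarrow> int vec) monoid" where
  "Aut_I n = (BijGroup (I_lattice n))\<lparr>carrier := I_automorphisms n\<rparr>"

lemma Aut_I_subgroup: "subgroup (I_automorphisms n) (BijGroup (I_lattice n))"
proof -
  let ?L = "I_lattice n"
  interpret group "BijGroup ?L" by (rule group_BijGroup)
  have add: "u + v \<in> ?L" and smult: "k \<cdot>\<^sub>v u \<in> ?L" if "u \<in> ?L" "v \<in> ?L" for u v k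
    using that by (auto simp: I_lattice_def)
  have mem: "f u \<in> ?L" if "f \<in> Bij ?L" "u \<in> ?L" for f u
    using that Bij_imp_funcset by blast
  show ?thesis
  proof (rule subgroupI)
    show "I_automorphisms n \<subseteq> carrier (BijGroup ?L)"
      by (auto simp: I_automorphisms_def BijGroup_def)
    have "(\<lambda>x\<in>?L. x) \<in> I_automorphisms n"
      using add smult by (auto simp: I_automorphisms_def id_Bij)
    then show "I_automorphisms n \<noteq> {}" by blast
  next
    fix f assume f: "f \<in> I_automorphisms n"
    then have fB: "f \<in> Bij ?L" by (simp add: I_automorphisms_def)
    let ?g = "\<lambda>x\<in>?L. inv_into ?L f x"
    have inj: "inj_on f ?L" and img: "f ` ?L = ?L"
      using fB by (auto simp: Bij_def bij_betw_def)
    have gB: "?g \<in> Bij ?L" using fB by (rule restrict_inv_into_Bij)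
    have gf: "?g (f a) = a" if "a \<in> ?L" for a
      using that inj mem[OF fB] by simp
    have pre: "\<exists>a\<in>?L. u = f a" if "u \<in> ?L" for u
      using that img by blast
    have "?g (u + v) = ?g u + ?g v \<and> ?g (k \<cdot>\<^sub>v u) = k \<cdot>\<^sub>v ?g u \<and>
        I_form n (?g u) (?g v) = I_form n u v" if uv: "u \<in> ?L" "v \<in> ?L" for u v k
    proof -
      obtain a b where a: "a \<in> ?L" "u = f a" and b: "b \<in> ?L" "v = f b"
        using pre[OF uv(1)] pre[OF uv(2)] by blast
      have 1: "u + v = f (a + b)" and 2: "k \<cdot>\<^sub>v u = f (k \<cdot>\<^sub>v a)"
        and 3: "I_form n u v = I_form n a b"
        using f a b by (auto simp: I_automorphisms_def)
      show ?thesis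
        unfolding 1 2 3 unfolding a(2) b(2)
        using gf a(1) b(1) add smult by metis
    qed
    then have "?g \<in> I_automorphisms n"
      unfolding I_automorphisms_def using gB by blast
    then show "inv\<^bsub>BijGroup ?L\<^esub> f \<in> I_automorphisms n"
      using inv_BijGroup[OF fB] by simp
  next
    fix f g assume fg: "f \<in> I_automorphisms n" "g \<in> I_automorphisms n"
    then have B: "f \<in> Bij ?L" "g \<in> Bij ?L" by (auto simp: I_automorphisms_def)
    have "compose ?L f g \<in> I_automorphisms n"
      using fg mem[OF B(2)] add smult compose_Bij[OF B]
      by (auto simp: I_automorphisms_def compose_def)
    then show "f \<otimes>\<^bsub>BijGroup ?L\<^esub> g \<in> I_automorphisms n"
      using B by (simp add: BijGroup_def)
  qed
qed

lemma Aut_I_group: "group (Aut_I n)"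
  unfolding Aut_I_def
  using subgroup.subgroup_is_group[OF Aut_I_subgroup group_BijGroup] .

lemma Aut_I_action: "group_action (Aut_I n) (I_lattice n) (\<lambda>f. f)"
proof -
  have "(\<lambda>f. f) \<in> hom (Aut_I n) (BijGroup (I_lattice n))"
    using subgroup.subset[OF Aut_I_subgroup] by (auto simp: hom_def Aut_I_def)
  then show ?thesis
    by (simp add: group_action_def group_hom_def group_hom_axioms_def Aut_I_group group_BijGroup)
qed

end

theory Submission
  imports Defs "HOL-Library.Function_Algebras"
begin

text \<open>
  Let \<open>u\<close> be primitive and characteristic of norm \<open>- m\<close> in a lattice \<open>L\<close> isometric to \<open>I\<^sub>1\<^sub>,\<^sub>n\<close>.
  Since \<open>m < n\<close>, one can write down a vector \<open>v\<close> of norm \<open>- m\<close> and an isotropic vector orthogonal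
  to it; reflecting \<open>v\<close> to \<open>u\<close> yields an isotropic \<open>z\<close> orthogonal to \<open>u\<close>, and a suitable choice
  by the Chinese remainder theorem makes \<open>z \<cdot> w = 1\<close> for some \<open>w\<close> orthogonal to \<open>u\<close>.
  If \<open>m > 1\<close>, this gives a vector \<open>r\<close> of norm \<open>- 1\<close> with \<open>r \<cdot> u = 1\<close> such that \<open>u + r\<close> is again
  primitive and characteristic, of norm \<open>- (m - 1)\<close>, in the complement of \<open>r\<close>. That complement is
  isometric to \<open>I\<^sub>1\<^sub>,\<^sub>n\<^sub>-\<^sub>1\<close> because an odd unimodular lattice that is rationally equivalent to the
  standard one has an orthonormal basis: split off vectors of norm \<open>- 1\<close>, found with isotropic
  vectors, and use Witt cancellation.
  If \<open>m = 1\<close>, the complement of \<open>u\<close> is even unimodular; it has an odd unimodular neighbour, which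
  by the same result has an orthonormal basis, and in such a basis the complement of \<open>u\<close> is the
  lattice \<open>D\<^sup>+\<close>. Hence any two such \<open>u\<close> are exchanged by an isometry.
\<close>

section \<open>Integers and parity\<close>

text \<open>The form is real-valued, since reflections and half vectors leave the lattice. Parity is
  therefore a predicate on reals that includes integrality; the two predicates are complementary
  only on integers.\<close>

definition even_real :: "real \<Rightarrow> bool" where
  "even_real r \<longleftrightarrow> (\<exists>k::int. r = 2 * of_int k)"

definition odd_real :: "real \<Rightarrow> bool" where
  "odd_real r \<longleftrightarrow> (\<exists>k::int. r = 2 * of_int k + 1)"

lemma even_real_iff: "even_real (of_int k) \<longleftrightarrow> even k"
proof -
  have "(of_int k = (2::real) * of_int l) \<longleftrightarrow> k = 2 * l" for l
    by linarith
  then show ?thesis by (auto simp: even_real_def)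
qed

lemma odd_real_iff: "odd_real (of_int k) \<longleftrightarrow> odd k"
proof -
  have "(of_int k = (2::real) * of_int l + 1) \<longleftrightarrow> k = 2 * l + 1" for l
    by linarith
  then show ?thesis by (auto simp: odd_real_def elim: oddE)
qed

text \<open>The least positive element generates, by division with remainder. The lemma is applied
  to the set of values that \<open>B z\<close> takes on a lattice or on the complement of a
  vector.\<close>

lemma int_subgroup_generator:
  fixes S :: "int set"
  assumes ne: "S \<noteq> {}" and add: "\<And>a b. a \<in> S \<Longrightarrow> b \<in> S \<Longrightarrow> a + b \<in> S"
    and neg: "\<And>a. a \<in> S \<Longrightarrow> - a \<in> S"
  shows "\<exists>g\<in>S. \<forall>a\<in>S. g dvd a"
proof -
  have diff: "a - b \<in> S" if "a \<in> S" "b \<in> S" for a b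
    using add[OF that(1) neg[OF that(2)]] by simp
  have zero: "0 \<in> S" using ne diff by fastforce
  show ?thesis
  proof (cases "S \<subseteq> {0}")
    case True
    then show ?thesis using zero by auto
  next
    case False
    then obtain a where a: "a \<in> S" "a \<noteq> 0" by auto
    define P where "P k \<longleftrightarrow> k > 0 \<and> int k \<in> S" for k :: nat
    have "P (nat \<bar>a\<bar>)" using a neg[OF a(1)] by (auto simp: P_def abs_if)
    then have "P (LEAST k. P k)" and least: "\<And>k. P k \<Longrightarrow> (LEAST k. P k) \<le> k"
      by (auto intro: LeastI Least_le)
    then obtain g :: nat where g: "g > 0" "int g \<in> S" and gl: "\<And>k. P k \<Longrightarrow> g \<le> k"
      by (auto simp: P_def)
    have mult: "int g * int k \<in> S" for k
      by (induction k) (auto simp: zero distrib_left add g)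
    have mult: "int g * k \<in> S" for k
      by (cases k rule: int_cases2) (use mult neg in auto)
    have "int g dvd b" if "b \<in> S" for b
    proof (rule ccontr)
      assume nd: "\<not> int g dvd b"
      have "b mod int g = b - int g * (b div int g)" by (simp add: minus_mult_div_eq_mod)
      then have "b mod int g \<in> S" using diff[OF that mult] by simp
      moreover have "b mod int g > 0"
        using nd g(1) by (metis dvd_eq_mod_eq_0 of_nat_0_less_iff order_le_less pos_mod_sign)
      ultimately have "P (nat (b mod int g))" by (simp add: P_def)
      from gl[OF this] show False
        using pos_mod_bound[of "int g" b] g(1) by linarith
    qed
    then show ?thesis using g(2) by blast
  qed
qed

lemma sum_single_support:
  fixes f :: "nat \<Rightarrow> int"
  assumes "j \<in> {1..N}" "\<And>i. i \<in> {1..N} \<Longrightarrow> i \<noteq> j \<Longrightarrow> f i = 0"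
  shows "(\<Sum>i = 1..N. f i) = f j"
proof -
  have "(\<Sum>i = 1..N. f i) = (\<Sum>i = 1..N. if i = j then f j else 0)"
    using assms by (intro sum.cong) auto
  then show ?thesis using assms(1) by simp
qed

text \<open>The polynomial is half of the product of a characteristic vector with an isotropic
  vector parametrized by \<open>y\<close>, see \<open>isotropic_vector\<close>. If \<open>p\<close>
  does not divide \<alpha>, take zero. Otherwise one nonzero entry suffices: for
  \<open>p = 2\<close> because \<open>k 1\<close> is odd; for odd \<open>p\<close> missing some
  \<open>k j\<close> because the entries 1 and -1 give values that differ by \<open>2 * k j\<close>;
  else because the entry 1 gives a value congruent to 2 \<beta>.\<close>

lemma quadratic_nonvanishing_mod_prime:
  fixes k :: "nat \<Rightarrow> int" and \<alpha> \<beta> p :: int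
  assumes N: "N \<ge> 1" and k: "\<And>i. i \<in> {1..N} \<Longrightarrow> odd (k i)" and p: "prime p"
    and nd: "odd p \<Longrightarrow> p dvd \<alpha> \<Longrightarrow> p dvd \<beta> \<Longrightarrow> (\<And>i. i \<in> {1..N} \<Longrightarrow> p dvd k i) \<Longrightarrow> False"
  shows "\<exists>y. \<not> p dvd \<alpha> + (\<Sum>i = 1..N. y i * k i) + 2 * \<beta> * (\<Sum>i = 1..N. y i * y i)"
proof -
  have single: "\<exists>y. \<not> p dvd \<alpha> + (\<Sum>i = 1..N. y i * k i) + 2 * \<beta> * (\<Sum>i = 1..N. y i * y i)"
    if "j \<in> {1..N}" "\<not> p dvd \<alpha> + t * k j + 2 * \<beta> * (t * t)" for j t
  proof (rule exI[of _ "\<lambda>i. if i = j then t else 0"])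
    show "\<not> p dvd \<alpha> + (\<Sum>i = 1..N. (if i = j then t else 0) * k i)
        + 2 * \<beta> * (\<Sum>i = 1..N. (if i = j then t else 0) * (if i = j then t else 0))"
      using that by (subst (1 2) sum_single_support[of j]) auto
  qed
  show ?thesis
  proof (cases "p dvd \<alpha>")
    case False
    then show ?thesis using single[of 1 0] N by auto
  next
    case pa: True
    show ?thesis
    proof (cases "p = 2")
      case True
      then show ?thesis using single[of 1 1] N k[of 1] pa by auto
    next
      case False
      have "p > 2" using prime_ge_2_int[OF p] False by simp
      then have "odd p" using p by (simp add: prime_odd_int)
      have p2: "\<not> p dvd 2" using zdvd_imp_le[of p 2] \<open>p > 2\<close> by auto
      show ?thesis
      proof (cases "\<exists>j\<in>{1..N}. \<not> p dvd k j")
        case True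
        then obtain j where j: "j \<in> {1..N}" "\<not> p dvd k j" by blast
        show ?thesis
        proof (rule ccontr)
          assume "\<nexists>y. \<not> p dvd \<alpha> + (\<Sum>i = 1..N. y i * k i) + 2 * \<beta> * (\<Sum>i = 1..N. y i * y i)"
          then have "p dvd \<alpha> + 1 * k j + 2 * \<beta> * (1 * 1)"
            "p dvd \<alpha> + (- 1) * k j + 2 * \<beta> * ((- 1) * (- 1))"
            using single[OF j(1)] by blast+
          then have "p dvd (\<alpha> + 1 * k j + 2 * \<beta> * (1 * 1)) - (\<alpha> + (- 1) * k j + 2 * \<beta> * ((- 1) * (- 1)))"
            by (rule dvd_diff)
          then have "p dvd 2 * k j" by simp
          then have "p dvd 2" using p j(2) by (simp add: prime_dvd_mult_iff)
          then show False using p2 by blast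
        qed
      next
        case nk: False
        then have "\<not> p dvd \<beta>" using nd \<open>odd p\<close> pa by blast
        have "p dvd k 1" using nk N by auto
        have nb: "\<not> p dvd 2 * \<beta>" using p p2 \<open>\<not> p dvd \<beta>\<close> by (simp add: prime_dvd_mult_iff)
        have "p dvd \<alpha> + 1 * k 1" using pa \<open>p dvd k 1\<close> by simp
        then have "\<not> p dvd \<alpha> + 1 * k 1 + 2 * \<beta> * (1 * 1)"
          using nb by (simp add: dvd_add_right_iff)
        then show ?thesis using single[of 1 1] N by auto
      qed
    qed
  qed
qed

lemma chinese_remainder_int_primes:
  fixes A :: "int set" and u :: "int \<Rightarrow> int"
  assumes fin: "finite A" and pr: "\<And>p. p \<in> A \<Longrightarrow> prime p"
  shows "\<exists>x. \<forall>p\<in>A. [x = u p] (mod p)"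
proof -
  have "\<exists>x. \<forall>p\<in>A. [x = nat (u p mod p)] (mod (nat p))"
  proof (rule chinese_remainder_nat[OF fin], intro ballI impI)
    fix p q assume pq: "p \<in> A" "q \<in> A" "p \<noteq> q"
    have "prime (nat p)" "prime (nat q)" using pr[OF pq(1)] pr[OF pq(2)] by (simp_all only: prime_int_nat_transfer)
    moreover have "nat p \<noteq> nat q"
      using prime_gt_0_int[OF pr[OF pq(1)]] prime_gt_0_int[OF pr[OF pq(2)]] pq(3) by auto
    ultimately show "coprime (nat p) (nat q)" by (rule primes_coprime)
  qed
  then obtain x where x: "\<And>p. p \<in> A \<Longrightarrow> [x = nat (u p mod p)] (mod (nat p))" by blast
  have "[int x = u p] (mod p)" if "p \<in> A" for p
  proof -
    have p: "p > 0" using pr[OF that] by (rule prime_gt_0_int)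
    have "[int x = int (nat (u p mod p))] (mod int (nat p))"
      using x[OF that] by (simp only: cong_int_iff)
    then show ?thesis using p by (simp add: cong_def)
  qed
  then show ?thesis by blast
qed

text \<open>Modulo \<open>p\<close> the value depends only on \<open>y\<close> modulo
  \<open>p\<close>. A good \<open>y\<close> is chosen for each prime divisor of \<open>M\<close>,
  and the choices are glued coordinate by coordinate with the Chinese remainder theorem.\<close>

lemma quadratic_coprime_value:
  fixes k :: "nat \<Rightarrow> int" and \<alpha> \<beta> M :: int
  assumes N: "N \<ge> 1" and k: "\<And>i. i \<in> {1..N} \<Longrightarrow> odd (k i)" and M: "M \<noteq> 0"
    and nd: "\<And>p. prime p \<Longrightarrow> odd p \<Longrightarrow> p dvd \<alpha> \<Longrightarrow> p dvd \<beta> \<Longrightarrow> (\<And>i. i \<in> {1..N} \<Longrightarrow> p dvd k i) \<Longrightarrow> False"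
  shows "\<exists>y. \<forall>p. prime p \<and> p dvd M \<longrightarrow>
    \<not> p dvd \<alpha> + (\<Sum>i = 1..N. y i * k i) + 2 * \<beta> * (\<Sum>i = 1..N. y i * y i)"
proof -
  define G where "G y = \<alpha> + (\<Sum>i = 1..N. y i * k i) + 2 * \<beta> * (\<Sum>i = 1..N. y i * y i)" for y
  define A where "A = {p. prime p \<and> p dvd M}"
  have "finite A" unfolding A_def using finite_divisors_int[OF M] by (rule rev_finite_subset) auto
  have "\<forall>p\<in>A. \<exists>y. \<not> p dvd G y"
  proof
    fix p assume "p \<in> A"
    then have p: "prime p" by (simp add: A_def)
    show "\<exists>y. \<not> p dvd G y"
      unfolding G_def by (rule quadratic_nonvanishing_mod_prime[OF N _ p]) (use k nd[OF p] in auto)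
  qed
  then obtain Y where Y: "\<And>p. p \<in> A \<Longrightarrow> \<not> p dvd G (Y p)" by metis
  have "\<forall>i. \<exists>x. \<forall>p\<in>A. [x = Y p i] (mod p)"
    using chinese_remainder_int_primes[OF \<open>finite A\<close>] by (auto simp: A_def)
  then obtain y where y: "\<And>i p. p \<in> A \<Longrightarrow> [y i = Y p i] (mod p)" by metis
  have "\<not> p dvd G y" if "p \<in> A" for p
  proof -
    have "[G y = G (Y p)] (mod p)"
      unfolding G_def by (intro cong_add cong_mult cong_sum cong_refl y that)
    then show ?thesis using Y[OF that] by (simp add: cong_dvd_iff)
  qed
  then show ?thesis unfolding A_def G_def by blast
qed

text \<open>The last two conditions make the vector \<open>c\<close> nonzero modulo every prime and, for \<open>m \<ge> 8\<close>,
  different from the all-ones vector modulo 2.\<close>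

lemma sum_of_squares_vector:
  assumes m: "1 \<le> m" "m \<le> N"
  shows "\<exists>c::nat \<Rightarrow> int. (\<Sum>i = 1..N. c i * c i) = int m \<and> (\<exists>i\<in>{1..N}. c i = 1) \<and>
    (8 \<le> m \<longrightarrow> (\<exists>i\<in>{1..N}. even (c i)))"
proof (cases "8 \<le> m")
  case False
  define c :: "nat \<Rightarrow> int" where "c i = (if i \<le> m then 1 else 0)" for i
  have "(\<Sum>i = 1..N. c i * c i) = (\<Sum>i = 1..m. 1)"
    by (rule sum.mono_neutral_cong_right) (use m in \<open>auto simp: c_def\<close>)
  then have "(\<Sum>i = 1..N. c i * c i) = int m" by simp
  moreover have "1 \<in> {1..N}" "c 1 = 1" using m by (auto simp: c_def)
  ultimately show ?thesis using False by blast
next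
  case True
  \<comment> \<open>One entry 2 and \<open>m - 4\<close> entries 1, the latter in positions 2 to
    \<open>m - 3\<close>.\<close>
  define c :: "nat \<Rightarrow> int" where "c i = (if i = 1 then 2 else if i \<le> m - 3 then 1 else 0)" for i
  have "(\<Sum>i = 1..N. c i * c i) = (\<Sum>i \<in> insert 1 {2..m - 3}. c i * c i)"
    by (rule sum.mono_neutral_right) (use m True in \<open>auto simp: c_def\<close>)
  also have "\<dots> = 4 + (\<Sum>i \<in> {2..m - 3}. 1)"
    by (subst sum.insert) (auto simp: c_def intro!: sum.cong)
  also have "\<dots> = int m" using True by (simp add: of_nat_diff)
  finally have "(\<Sum>i = 1..N. c i * c i) = int m" .
  moreover have "2 \<in> {1..N}" "c 2 = 1" "1 \<in> {1..N}" "even (c 1)"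
    using True m by (auto simp: c_def)
  ultimately show ?thesis by blast
qed

section \<open>Unimodular lattices\<close>

definition eta :: "nat \<Rightarrow> real" where
  "eta i = (if i = 0 then 1 else - 1)"

lemma eta_sq [simp]: "eta i * eta i = 1" "eta i * (eta i * r) = r"
  by (auto simp: eta_def)

text \<open>Degeneracy is allowed, because the instance \<open>lorentz n\<close> lives on all
  functions from \<open>nat\<close> and ignores the coordinates beyond \<open>n\<close>.
  Nondegeneracy is a condition on lattices instead.\<close>

locale form_space =
  fixes B :: "'a::real_vector \<Rightarrow> 'a \<Rightarrow> real"
  assumes B_add_left [simp]: "B (x + y) z = B x z + B y z"
    and B_scale_left [simp]: "B (c *\<^sub>R x) y = c * B x y"
    and B_sym: "B x y = B y x"
begin

lemma B_add_right [simp]: "B z (x + y) = B z x + B z y"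
  by (metis B_add_left B_sym)

lemma B_scale_right [simp]: "B x (c *\<^sub>R y) = c * B x y"
  by (metis B_scale_left B_sym)

lemma B_zero [simp]: "B 0 x = 0" "B x 0 = 0"
  using B_scale_left[of 0 0 x] B_scale_right[of x 0 0] by simp_all

lemma B_minus [simp]: "B (- x) y = - B x y" "B y (- x) = - B y x"
  using B_scale_left[of "-1" x y] B_scale_right[of y "-1" x] by simp_all

lemma B_diff [simp]: "B (x - y) z = B x z - B y z" "B z (x - y) = B z x - B z y"
  using B_add_left[of x "- y" z] B_add_right[of z x "- y"] by simp_all

lemma B_sum_left: "B (\<Sum>i\<in>A. f i) y = (\<Sum>i\<in>A. B (f i) y)"
  by (induction A rule: infinite_finite_induct) auto

lemma B_sum_right: "B y (\<Sum>i\<in>A. f i) = (\<Sum>i\<in>A. B y (f i))"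
  by (induction A rule: infinite_finite_induct) auto

definition integral_lattice :: "'a set \<Rightarrow> bool" where
  "integral_lattice L \<longleftrightarrow> 0 \<in> L \<and> (\<forall>x\<in>L. \<forall>y\<in>L. x + y \<in> L) \<and> (\<forall>x\<in>L. - x \<in> L)
     \<and> (\<forall>x\<in>L. \<forall>y\<in>L. B x y \<in> \<int>) \<and> (\<forall>x\<in>L. (\<forall>y\<in>L. B x y = 0) \<longrightarrow> x = 0)"

text \<open>Self-duality stated without a basis or a determinant. Rank and signature enter only
  through \<open>onb\<close> and \<open>frame\<close>.\<close>

definition unimodular :: "'a set \<Rightarrow> bool" where
  "unimodular L \<longleftrightarrow> integral_lattice L \<and>
     (\<forall>\<phi>. (\<forall>x\<in>L. \<phi> x \<in> \<int>) \<and> (\<forall>x\<in>L. \<forall>y\<in>L. \<phi> (x + y) = \<phi> x + \<phi> y)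
          \<longrightarrow> (\<exists>y\<in>L. \<forall>x\<in>L. \<phi> x = B y x))"

definition perp :: "'a set \<Rightarrow> 'a \<Rightarrow> 'a set" where
  "perp L r = {x \<in> L. B x r = 0}"

definition orthonormal :: "nat \<Rightarrow> (nat \<Rightarrow> 'a) \<Rightarrow> bool" where
  "orthonormal n e \<longleftrightarrow> (\<forall>i\<le>n. \<forall>j\<le>n. B (e i) (e j) = (if i = j then eta i else 0))"

text \<open>Spanning is expressed as maximality; for unimodular \<open>L\<close> the integral
  expansion follows from it in \<open>onb_expand\<close>.\<close>

definition onb :: "'a set \<Rightarrow> nat \<Rightarrow> (nat \<Rightarrow> 'a) \<Rightarrow> bool" where
  "onb L n e \<longleftrightarrow> orthonormal n e \<and> (\<forall>i\<le>n. e i \<in> L) \<and>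
     (\<forall>x\<in>L. (\<forall>i\<le>n. B x (e i) = 0) \<longrightarrow> x = 0)"

text \<open>Rational equivalence with the standard form: the orthonormal vectors need only lie in
  the rational span of \<open>L\<close>, with common denominator \<open>d\<close>. This passes to
  complements and to neighbours, where an orthonormal basis is not yet known.\<close>

definition frame :: "'a set \<Rightarrow> nat \<Rightarrow> bool" where
  "frame L n \<longleftrightarrow> (\<exists>e. \<exists>d::int. d \<noteq> 0 \<and> orthonormal n e \<and> (\<forall>i\<le>n. of_int d *\<^sub>R e i \<in> L) \<and>
     (\<forall>x\<in>L. (\<forall>i\<le>n. B x (e i) = 0) \<longrightarrow> x = 0))"

lemma onb_imp_frame: "onb L n e \<Longrightarrow> frame L n"
  unfolding onb_def frame_def by (intro exI[of _ e] exI[of _ 1]) auto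

lemma orthonormalD: "orthonormal n e \<Longrightarrow> i \<le> n \<Longrightarrow> j \<le> n \<Longrightarrow>
    B (e i) (e j) = (if i = j then eta i else 0)"
  by (simp add: orthonormal_def)

context
  fixes L assumes L: "unimodular L"
begin

lemma uni_zero: "0 \<in> L"
  and uni_add: "x \<in> L \<Longrightarrow> y \<in> L \<Longrightarrow> x + y \<in> L"
  and uni_minus: "x \<in> L \<Longrightarrow> - x \<in> L"
  and uni_Ints: "x \<in> L \<Longrightarrow> y \<in> L \<Longrightarrow> B x y \<in> \<int>"
  using L by (simp_all add: unimodular_def integral_lattice_def)

lemma uni_nondeg: "x \<in> L \<Longrightarrow> (\<And>y. y \<in> L \<Longrightarrow> B x y = 0) \<Longrightarrow> x = 0"
  using L by (simp add: unimodular_def integral_lattice_def)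

lemma uni_dual:
  assumes "\<And>x. x \<in> L \<Longrightarrow> \<phi> x \<in> \<int>" "\<And>x y. x \<in> L \<Longrightarrow> y \<in> L \<Longrightarrow> \<phi> (x + y) = \<phi> x + \<phi> y"
  shows "\<exists>y\<in>L. \<forall>x\<in>L. \<phi> x = B y x"
  using L[unfolded unimodular_def, THEN conjunct2, rule_format, of \<phi>] assms by simp

lemma uni_diff: "x \<in> L \<Longrightarrow> y \<in> L \<Longrightarrow> x - y \<in> L"
  using uni_add[of x "- y"] uni_minus[of y] by simp

lemma uni_scale: assumes "x \<in> L" "c \<in> \<int>" shows "c *\<^sub>R x \<in> L"
proof -
  have "of_int k *\<^sub>R x \<in> L" for k
  proof (induction k rule: int_induct[where k = 0])
    case base
    then show ?case by (simp add: uni_zero)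
  next
    case (step1 i)
    then show ?case by (simp add: scaleR_add_left uni_add assms(1))
  next
    case (step2 i)
    then show ?case by (simp add: scaleR_diff_left uni_diff assms(1))
  qed
  then show ?thesis using assms(2) by (auto elim: Ints_cases)
qed

lemma uni_sum: "(\<And>i. i \<in> A \<Longrightarrow> f i \<in> L) \<Longrightarrow> (\<Sum>i\<in>A. f i) \<in> L"
  by (induction A rule: infinite_finite_induct) (auto simp: uni_zero uni_add)

lemma uni_int: assumes "x \<in> L" "y \<in> L" obtains k :: int where "B x y = of_int k"
  using uni_Ints[OF assms] by (auto elim: Ints_cases)

text \<open>The functional \<open>B y\<close> divided by \<open>p\<close> is integral, so a lattice
  vector \<open>w\<close> represents it, and nondegeneracy identifies \<open>y\<close> with
  \<open>p\<close> times \<open>w\<close>.\<close>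

lemma uni_divide:
  assumes "y \<in> L" "p \<noteq> 0" "\<And>x. x \<in> L \<Longrightarrow> B y x / of_int p \<in> \<int>"
  shows "\<exists>w\<in>L. y = of_int p *\<^sub>R w"
proof -
  have "\<exists>w\<in>L. \<forall>x\<in>L. B y x / of_int p = B w x"
    by (rule uni_dual) (use assms in \<open>auto simp: add_divide_distrib\<close>)
  then obtain w where w: "w \<in> L" "\<And>x. x \<in> L \<Longrightarrow> B y x = of_int p * B w x"
    using assms(2) by (auto simp: field_simps)
  have "y - of_int p *\<^sub>R w = 0"
  proof (rule uni_nondeg)
    show "y - of_int p *\<^sub>R w \<in> L" by (intro uni_diff uni_scale assms w(1)) auto
    show "B (y - of_int p *\<^sub>R w) x = 0" if "x \<in> L" for x
      using w(2)[OF that] by simp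
  qed
  then show ?thesis using w(1) by (intro bexI[of _ w]) auto
qed

text \<open>The values of \<open>B z\<close> form a subgroup of the integers with a generator
  \<open>g\<close>. Dividing \<open>z\<close> by \<open>g\<close> stays in the lattice by
  \<open>uni_divide\<close>, and the quotient takes the value 1.\<close>

lemma primitive_multiple:
  assumes z: "z \<in> L" "z \<noteq> 0"
  shows "\<exists>c::int. \<exists>z1\<in>L. \<exists>w\<in>L. z = of_int c *\<^sub>R z1 \<and> B z1 w = 1"
proof -
  define S where "S = {k::int. \<exists>x\<in>L. B z x = of_int k}"
  have "\<exists>g\<in>S. \<forall>a\<in>S. g dvd a"
  proof (rule int_subgroup_generator)
    have "0 \<in> S" unfolding S_def using uni_zero by (auto intro!: bexI[of _ 0])
    then show "S \<noteq> {}" by auto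
    show "a + b \<in> S" if "a \<in> S" "b \<in> S" for a b
    proof -
      from that obtain x y where "x \<in> L" "y \<in> L" "B z x = of_int a" "B z y = of_int b"
        by (auto simp: S_def)
      then show ?thesis unfolding S_def by (auto intro!: bexI[of _ "x + y"] uni_add)
    qed
    show "- a \<in> S" if "a \<in> S" for a
    proof -
      from that obtain x where "x \<in> L" "B z x = of_int a" by (auto simp: S_def)
      then show ?thesis unfolding S_def by (auto intro!: bexI[of _ "- x"] uni_minus)
    qed
  qed
  then obtain g where g: "g \<in> S" "\<And>a. a \<in> S \<Longrightarrow> g dvd a" by blast
  have "\<exists>x\<in>L. B z x \<noteq> 0" using z uni_nondeg by blast
  then obtain x where x: "x \<in> L" "B z x \<noteq> 0" by blast
  obtain k where k: "B z x = of_int k" by (rule uni_int[OF z(1) x(1)])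
  have g0: "g \<noteq> 0"
  proof
    assume "g = 0"
    moreover have "k \<in> S" using x k by (auto simp: S_def)
    ultimately show False using g(2)[of k] x k by simp
  qed
  have "B z x / of_int g \<in> \<int>" if xL: "x \<in> L" for x
  proof -
    obtain k where k: "B z x = of_int k" by (rule uni_int[OF z(1) xL])
    then have "k \<in> S" using xL by (auto simp: S_def)
    then obtain l where "k = g * l" using g(2) by (blast elim: dvdE)
    then show ?thesis using k g0 by simp
  qed
  from uni_divide[OF z(1) g0 this] obtain z1 where z1: "z1 \<in> L" "z = of_int g *\<^sub>R z1" by blast
  obtain w where w: "w \<in> L" "B z w = of_int g" using g(1) by (auto simp: S_def)
  have "B z1 w = 1" using w z1 g0 by simp
  then show ?thesis using z1 w by (intro exI[of _ g] bexI[of _ z1] bexI[of _ w] conjI)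
qed

text \<open>A vector of norm 1 or -1 splits off: the orthogonal projection \<open>pr\<close> has
  integral coefficients. A functional on the complement is pulled back along \<open>pr\<close>,
  represented in \<open>L\<close>, and its representative is projected.\<close>

lemma unimodular_perp:
  assumes r: "r \<in> L" "B r r = s" "s = 1 \<or> s = - 1"
  shows "unimodular (perp L r)"
proof -
  have ss: "s * s = 1" "s \<in> \<int>" using r by auto
  define pr where "pr x = x - (s * B x r) *\<^sub>R r" for x
  have pr: "pr x \<in> perp L r" if "x \<in> L" for x
  proof -
    have "B (pr x) r = B x r - (s * s) * B x r"
      using r by (simp add: pr_def)
    moreover have "pr x \<in> L" unfolding pr_def
      by (intro uni_diff uni_scale that r(1) Ints_mult ss uni_Ints)
    ultimately show ?thesis using ss by (simp add: perp_def)
  qed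
  have pr_id: "pr x = x" if "x \<in> perp L r" for x using that by (simp add: pr_def perp_def)
  have Bpr: "B (pr x) y = B x y" if "y \<in> perp L r" for x y
    using that by (simp add: pr_def perp_def B_sym[of r])
  show ?thesis
    unfolding unimodular_def integral_lattice_def
  proof (intro conjI ballI allI impI)
    show "0 \<in> perp L r" by (simp add: perp_def uni_zero)
    show "x + y \<in> perp L r" if "x \<in> perp L r" "y \<in> perp L r" for x y
      using that by (auto simp: perp_def uni_add)
    show "- x \<in> perp L r" if "x \<in> perp L r" for x
      using that by (auto simp: perp_def uni_minus)
    show "B x y \<in> \<int>" if "x \<in> perp L r" "y \<in> perp L r" for x y
      using that by (auto simp: perp_def uni_Ints)
    show "x = 0" if x: "x \<in> perp L r" and 0: "\<forall>y\<in>perp L r. B x y = 0" for x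
    proof (rule uni_nondeg)
      show "x \<in> L" using x by (simp add: perp_def)
      show "B x y = 0" if "y \<in> L" for y
        using 0 pr[OF that] Bpr[OF x, of y] by (metis B_sym)
    qed
    fix \<phi> :: "'a \<Rightarrow> real"
    assume \<phi>: "(\<forall>x\<in>perp L r. \<phi> x \<in> \<int>) \<and>
      (\<forall>x\<in>perp L r. \<forall>y\<in>perp L r. \<phi> (x + y) = \<phi> x + \<phi> y)"
    have pr_add: "pr (x + y) = pr x + pr y" for x y
      by (simp add: pr_def algebra_simps)
    have "\<exists>y\<in>L. \<forall>x\<in>L. \<phi> (pr x) = B y x"
      by (rule uni_dual) (use \<phi> pr pr_add in auto)
    then obtain y where y: "y \<in> L" "\<And>x. x \<in> L \<Longrightarrow> \<phi> (pr x) = B y x" by blast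
    show "\<exists>y\<in>perp L r. \<forall>x\<in>perp L r. \<phi> x = B y x"
    proof (intro bexI[of _ "pr y"] ballI)
      fix x assume x: "x \<in> perp L r"
      then have "\<phi> x = B y x" using y(2)[of x] pr_id[OF x] by (simp add: perp_def)
      then show "\<phi> x = B (pr y) x" using Bpr[OF x] by simp
    qed (rule pr[OF y(1)])
  qed
qed

text \<open>Witt cancellation: the reflection exchanging \<open>q\<close> with plus or minus the last frame vector
  maps the other frame vectors into the complement of \<open>q\<close>.\<close>

lemma frame_perp:
  assumes fr: "frame L (Suc n)" and q: "q \<in> L" "B q q = - 1"
  shows "frame (perp L q) n"
proof -
  obtain e and d :: int where d: "d \<noteq> 0" and e: "orthonormal (Suc n) e"
    and de: "\<And>i. i \<le> Suc n \<Longrightarrow> of_int d *\<^sub>R e i \<in> L"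
    and nd: "\<And>x. x \<in> L \<Longrightarrow> (\<And>i. i \<le> Suc n \<Longrightarrow> B x (e i) = 0) \<Longrightarrow> x = 0"
    using fr unfolding frame_def by blast
  define f where "f = e (Suc n)"
  have ff: "B f f = - 1" using orthonormalD[OF e, of "Suc n" "Suc n"] by (simp add: f_def eta_def)
  \<comment> \<open>The sign keeps the reflecting vector \<open>w\<close> from being isotropic: its
    norm is -2 \<epsilon> (\<epsilon> + \<open>B q f\<close>).\<close>
  define \<epsilon> :: real where "\<epsilon> = (if B q f = - 1 then - 1 else 1)"
  have \<epsilon>: "\<epsilon> * \<epsilon> = 1" "\<epsilon> \<in> \<int>" "\<epsilon> + B q f \<noteq> 0" "\<And>r. \<epsilon> * (\<epsilon> * r) = r"
    by (auto simp: \<epsilon>_def)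
  define w where "w = q - \<epsilon> *\<^sub>R f"
  define N where "N = B w w"
  have N: "N = - 2 * \<epsilon> * (\<epsilon> + B q f)"
    using \<epsilon>(1,4) by (simp add: N_def w_def q ff B_sym[of f q] algebra_simps)
  have N0: "N \<noteq> 0" using N \<epsilon> by auto
  define \<rho> where "\<rho> x = x - (2 * B x w / N) *\<^sub>R w" for x
  have \<rho>_adj: "B (\<rho> x) y = B x (\<rho> y)" for x y
    by (simp add: \<rho>_def B_sym[of w y])
  have \<rho>\<rho>: "\<rho> (\<rho> x) = x" for x
  proof -
    have "B (\<rho> x) w = - B x w" using N0 by (simp add: \<rho>_def N_def[symmetric])
    then show ?thesis by (simp add: \<rho>_def[of "\<rho> x"]) (simp add: \<rho>_def)
  qed
  have "B f w = \<epsilon> + B q f" using \<epsilon> by (simp add: w_def ff B_sym[of f q])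
  then have "2 * B f w = - \<epsilon> * N" using \<epsilon>(4)[of "2 * (\<epsilon> + B q f)"] by (simp add: N algebra_simps)
  then have "2 * B f w / N = - \<epsilon>" using N0 by simp
  then have \<rho>f: "\<rho> f = \<epsilon> *\<^sub>R q"
    using \<epsilon>(1) by (simp add: \<rho>_def w_def algebra_simps)
  \<comment> \<open>Clearing denominators: \<open>W\<close> lies in \<open>L\<close>, so
    \<open>K = B W W\<close> is an integer, and \<open>K\<close> times the reflection maps
    \<open>L\<close> into itself.\<close>
  define W where "W = of_int d *\<^sub>R w"
  have WL: "W \<in> L"
  proof -
    have "W = of_int d *\<^sub>R q - \<epsilon> *\<^sub>R (of_int d *\<^sub>R e (Suc n))"
      by (simp add: W_def w_def f_def algebra_simps)
    moreover have "of_int d *\<^sub>R q - \<epsilon> *\<^sub>R (of_int d *\<^sub>R e (Suc n)) \<in> L"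
      by (intro uni_diff uni_scale q(1) \<epsilon>(2) de) auto
    ultimately show ?thesis by simp
  qed
  obtain K where K: "B W W = of_int K" by (rule uni_int[OF WL WL])
  then have K': "of_int K = of_int d * of_int d * N" by (simp add: W_def N_def)
  have K0: "K \<noteq> 0" using K' d N0 by (metis mult_eq_0_iff of_int_0 of_int_eq_0_iff)
  have \<rho>K: "of_int K *\<^sub>R \<rho> x = of_int K *\<^sub>R x - (2 * B x W) *\<^sub>R W" for x
    using N0 by (simp add: \<rho>_def K' W_def algebra_simps)
  have \<rho>L: "of_int K *\<^sub>R \<rho> x \<in> L" if "x \<in> L" for x
    unfolding \<rho>K using that WL by (auto intro!: uni_diff uni_scale Ints_mult uni_Ints)
  define e' where "e' i = \<rho> (e i)" for i
  have e'q: "B (e' i) q = 0" if "i \<le> n" for i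
  proof -
    have "\<epsilon> * B (e' i) q = B (\<rho> (e i)) (\<rho> f)" by (simp add: e'_def \<rho>f)
    also have "\<dots> = B (e i) f" by (simp add: \<rho>_adj \<rho>\<rho>)
    also have "\<dots> = 0" using that orthonormalD[OF e, of i "Suc n"] by (simp add: f_def)
    finally show ?thesis using \<epsilon> by auto
  qed
  show ?thesis
    unfolding frame_def
  proof (intro exI[of _ e'] exI[of _ "K * d"] conjI allI impI ballI)
    show "K * d \<noteq> 0" using K0 d by simp
    show "orthonormal n e'"
      using orthonormalD[OF e] by (auto simp: orthonormal_def e'_def \<rho>_adj \<rho>\<rho>)
    show "of_int (K * d) *\<^sub>R e' i \<in> perp L q" if "i \<le> n" for i
    proof -
      have "of_int (K * d) *\<^sub>R e' i = of_int K *\<^sub>R \<rho> (of_int d *\<^sub>R e i)"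
        by (simp add: e'_def \<rho>_def algebra_simps)
      then have "of_int (K * d) *\<^sub>R e' i \<in> L" using \<rho>L de that by simp
      then show ?thesis using e'q[OF that] by (simp add: perp_def)
    qed
    fix x assume x: "x \<in> perp L q" and o: "\<forall>i\<le>n. B x (e' i) = 0"
    have xL: "x \<in> L" using x by (simp add: perp_def)
    have "of_int K *\<^sub>R \<rho> x = 0"
    proof (rule nd[OF \<rho>L[OF xL]])
      fix i assume i: "i \<le> Suc n"
      have "B x (\<rho> (e i)) = 0"
      proof (cases "i \<le> n")
        case True
        then show ?thesis using o by (simp add: e'_def)
      next
        case False
        then have "e i = f" using i by (simp add: f_def le_Suc_eq)
        then show ?thesis using \<rho>f x by (simp add: perp_def)
      qed
      then show "B (of_int K *\<^sub>R \<rho> x) (e i) = 0" by (simp add: \<rho>_adj)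
    qed
    then have "\<rho> x = 0" using K0 by simp
    then show "x = 0" using \<rho>\<rho>[of x] by (simp add: \<rho>_def)
  qed
qed

end

text \<open>Induction on the rank. A primitive isotropic \<open>z\<close> and a vector of odd norm
  with product 1 with \<open>z\<close> yield \<open>q\<close> of norm -1. Its complement is again
  unimodular, has a frame by Witt cancellation, and is again odd.\<close>

theorem odd_unimodular_onb:
  assumes "unimodular L" "frame L n" "x \<in> L" "odd_real (B x x)"
  shows "\<exists>e. onb L n e"
  using assms
proof (induction n arbitrary: L x)
  case 0
  note L = \<open>unimodular L\<close>
  obtain e and d :: int where d: "d \<noteq> 0" and e: "orthonormal 0 e"
    and de: "of_int d *\<^sub>R e 0 \<in> L"
    and nd: "\<And>x. x \<in> L \<Longrightarrow> B x (e 0) = 0 \<Longrightarrow> x = 0"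
    using \<open>frame L 0\<close> unfolding frame_def by auto
  have e0: "B (e 0) (e 0) = 1" using orthonormalD[OF e, of 0 0] by (simp add: eta_def)
  have span: "x = B x (e 0) *\<^sub>R e 0" if "x \<in> L" for x
  proof -
    \<comment> \<open>The factor \<open>d * d\<close> puts the difference into \<open>L\<close>,
      where \<open>nd\<close> applies.\<close>
    have "of_int (d * d) *\<^sub>R x - B x (of_int d *\<^sub>R e 0) *\<^sub>R (of_int d *\<^sub>R e 0) = 0"
    proof (rule nd)
      have "B x (of_int d *\<^sub>R e 0) *\<^sub>R (of_int d *\<^sub>R e 0) \<in> L"
        by (rule uni_scale[OF L de uni_Ints[OF L that de]])
      moreover have "of_int (d * d) *\<^sub>R x \<in> L" by (intro uni_scale L that) auto
      ultimately show "of_int (d * d) *\<^sub>R x - B x (of_int d *\<^sub>R e 0) *\<^sub>R (of_int d *\<^sub>R e 0) \<in> L"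
        by (intro uni_diff L)
    qed (simp add: e0)
    then have "of_int (d * d) *\<^sub>R (x - B x (e 0) *\<^sub>R e 0) = 0"
      by (simp add: algebra_simps)
    then show ?thesis using d by simp
  qed
  have "of_int d *\<^sub>R e 0 \<noteq> 0" using d e0 by auto
  from primitive_multiple[OF L de this] obtain z w where zw: "z \<in> L" "w \<in> L" "B z w = 1"
    by blast
  obtain a b where ab: "B z z = of_int a" "B w w = of_int b" using uni_int L zw by metis
  \<comment> \<open>In rank one, \<open>s * s\<close> and \<open>t * t\<close> are integers with
    product 1, so \<open>z\<close> has norm 1.\<close>
  obtain s t where st: "z = s *\<^sub>R e 0" "w = t *\<^sub>R e 0" using span zw by metis
  have "s * t = 1" using zw(3) st e0 by (simp add: mult.commute)
  moreover have sq: "of_int a = s * s" "of_int b = t * t" using ab st e0 by auto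
  ultimately have "of_int (a * b) = (1::real)" by (simp add: algebra_simps)
  then have "a * b = 1" by (simp only: of_int_eq_1_iff)
  moreover have "a \<ge> 0" using sq(1) by (metis of_int_0_le_iff zero_le_square)
  ultimately have "a = 1" by (auto simp: zmult_eq_1_iff)
  then have z1: "B z z = 1" using ab by simp
  have s: "s \<noteq> 0" using \<open>s * t = 1\<close> by auto
  show ?case
    unfolding onb_def orthonormal_def
    by (rule exI[of _ "\<lambda>_. z"]) (use zw z1 nd st s in \<open>auto simp: eta_def\<close>)
next
  case (Suc n)
  note L = \<open>unimodular L\<close>
  obtain e and d :: int where d: "d \<noteq> 0" and e: "orthonormal (Suc n) e"
    and de: "\<And>i. i \<le> Suc n \<Longrightarrow> of_int d *\<^sub>R e i \<in> L"
    using \<open>frame L (Suc n)\<close> unfolding frame_def by auto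
  \<comment> \<open>Isotropic because \<open>e 0\<close> and \<open>e 1\<close> have opposite norms;
    \<open>d\<close> makes it a lattice vector.\<close>
  define z0 where "z0 = of_int d *\<^sub>R e 0 + of_int d *\<^sub>R e 1"
  have ee: "B (e 0) (e 0) = 1" "B (e 1) (e 1) = - 1" "B (e 0) (e 1) = 0" "B (e 1) (e 0) = 0"
    using orthonormalD[OF e] by (auto simp: eta_def)
  have z0L: "z0 \<in> L" unfolding z0_def using de by (intro uni_add[OF L]) auto
  have "B z0 (e 0) \<noteq> 0" using d ee by (simp add: z0_def)
  then have "z0 \<noteq> 0" by auto
  from primitive_multiple[OF L z0L this] obtain c :: int and z w where
    zw: "z \<in> L" "w \<in> L" "z0 = of_int c *\<^sub>R z" "B z w = 1" by blast
  have "c \<noteq> 0" using zw \<open>z0 \<noteq> 0\<close> by auto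
  have "B z0 z0 = 0" using ee by (simp add: z0_def)
  then have zz: "B z z = 0" using zw \<open>c \<noteq> 0\<close> by simp
  obtain y where y: "y \<in> L" "B y z = 1" "odd_real (B y y)"
  proof (cases "odd_real (B w w)")
    case True
    then show ?thesis using that zw by (simp add: B_sym)
  next
    case False
    obtain b where b: "B w w = of_int b" by (rule uni_int[OF L zw(2) zw(2)])
    obtain a where a: "B x x = of_int a" by (rule uni_int[OF L Suc.prems(3) Suc.prems(3)])
    obtain h where h: "B x z = of_int h" by (rule uni_int[OF L Suc.prems(3) zw(1)])
    obtain k where k: "B x w = of_int k" by (rule uni_int[OF L Suc.prems(3) zw(2)])
    have par: "even b" "odd a" using False b a Suc.prems by (auto simp: odd_real_iff)
    \<comment> \<open>If \<open>w\<close> has even norm, adding a multiple of it to the odd vector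
      \<open>x\<close> corrects the product with \<open>z\<close> to 1 and keeps the norm
      odd.\<close>
    define y where "y = x + of_int (1 - h) *\<^sub>R w"
    have "y \<in> L" unfolding y_def using Suc.prems zw L by (auto intro!: uni_add uni_scale)
    moreover have "B y z = 1" using h zw by (simp add: y_def B_sym[of w z])
    moreover have "B y y = of_int (a + 2 * (1 - h) * k + (1 - h) * (1 - h) * b)"
      using a b k by (simp add: y_def B_sym[of w x] algebra_simps)
    then have "odd_real (B y y)" using par by (simp only: odd_real_iff) simp
    ultimately show ?thesis using that by blast
  qed
  then obtain k :: int where k: "B y y = 2 * of_int k + 1" by (auto simp: odd_real_def)
  \<comment> \<open>Each subtraction of the isotropic \<open>z\<close> lowers the norm by 2, so the
    norm becomes \<open>(2 * k + 1) - 2 * (k + 1)\<close>, which is -1.\<close>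
  define q where "q = y - of_int (k + 1) *\<^sub>R z"
  have qL: "q \<in> L" unfolding q_def using y zw L by (auto intro!: uni_diff uni_scale)
  have qq: "B q q = - 1" using y k zz by (simp add: q_def B_sym[of z y] algebra_simps)
  have qz: "B q z = 1" using y zz by (simp add: q_def)
  have "unimodular (perp L q)" using unimodular_perp[OF L qL qq] by simp
  moreover have "frame (perp L q) n" using frame_perp[OF L Suc.prems(2) qL qq] .
  \<comment> \<open>This vector has norm -1 + 2 = 1 and shows that the complement is odd.\<close>
  moreover have "q + z \<in> perp L q"
    using qL zw L qq qz by (auto simp: perp_def B_sym[of z q] intro: uni_add)
  moreover have "odd_real (B (q + z) (q + z))"
    using qq qz zz by (auto simp: odd_real_def B_sym[of z q])
  ultimately obtain f where f: "onb (perp L q) n f" using Suc.IH by blast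
  have fo: "orthonormal n f" and fL: "\<And>i. i \<le> n \<Longrightarrow> f i \<in> perp L q"
    and fn: "\<And>x. x \<in> perp L q \<Longrightarrow> (\<And>i. i \<le> n \<Longrightarrow> B x (f i) = 0) \<Longrightarrow> x = 0"
    using f unfolding onb_def by auto
  have "onb L (Suc n) (f(Suc n := q))"
    unfolding onb_def
  proof (intro conjI ballI impI allI)
    show "orthonormal (Suc n) (f(Suc n := q))"
    proof -
      have "B (f i) q = 0" "B q (f i) = 0" if "i \<le> n" for i
        using fL[OF that] by (simp_all add: perp_def B_sym[of q "f i"])
      then show ?thesis
        using fo qq unfolding orthonormal_def by (auto simp: le_Suc_eq eta_def)
    qed
    show "(f(Suc n := q)) i \<in> L" if "i \<le> Suc n" for i
      using that fL qL by (auto simp: le_Suc_eq perp_def)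
    show "x = 0" if "x \<in> L" "\<forall>i\<le>Suc n. B x ((f(Suc n := q)) i) = 0" for x
    proof (rule fn)
      have "B x q = 0" using that(2) by (auto dest: spec[of _ "Suc n"])
      then show "x \<in> perp L q" using that(1) by (simp add: perp_def)
      show "B x (f i) = 0" if "i \<le> n" for i
        using that \<open>\<forall>i\<le>Suc n. _\<close> by (auto dest: spec[of _ i])
    qed
  qed
  then show ?case by blast
qed

section \<open>Isotropic vectors orthogonal to a characteristic vector\<close>

definition characteristic :: "'a set \<Rightarrow> 'a \<Rightarrow> bool" where
  "characteristic L u \<longleftrightarrow> u \<in> L \<and> (\<forall>x\<in>L. even_real (B u x - B x x))"

text \<open>The lattice as a hyperbolic plane spanned by \<open>E\<close> and \<open>F\<close> plus
  \<open>N\<close> orthogonal vectors of norm -1. In such coordinates isotropic vectors are easy to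
  parametrize.\<close>

definition hyperbolic_basis :: "'a set \<Rightarrow> nat \<Rightarrow> 'a \<Rightarrow> 'a \<Rightarrow> (nat \<Rightarrow> 'a) \<Rightarrow> bool" where
  "hyperbolic_basis L N E F g \<longleftrightarrow> E \<in> L \<and> F \<in> L \<and> (\<forall>i\<in>{1..N}. g i \<in> L) \<and>
     B E E = 0 \<and> B F F = 0 \<and> B E F = 1 \<and> (\<forall>i\<in>{1..N}. B E (g i) = 0 \<and> B F (g i) = 0) \<and>
     (\<forall>i\<in>{1..N}. \<forall>j\<in>{1..N}. B (g i) (g j) = (if i = j then - 1 else 0)) \<and>
     (\<forall>x\<in>L. x = B x F *\<^sub>R E + B x E *\<^sub>R F - (\<Sum>i = 1..N. B x (g i) *\<^sub>R g i))"

text \<open>The isotropic vectors \<open>e 0 + e 1\<close> and \<open>e 0 + e 2\<close> have product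
  1, and \<open>e 0 + e 1 + e 2\<close> is orthogonal to both with norm -1. These three recover
  \<open>e 0\<close>, \<open>e 1\<close>, \<open>e 2\<close>, so together with the remaining
  \<open>e i\<close> they span.\<close>

lemma onb_hyperbolic_basis:
  assumes L: "unimodular L" and onb: "onb L (Suc N) e" and N: "N \<ge> 1"
  shows "\<exists>E F g. hyperbolic_basis L N E F g"
proof -
  define E F where "E = e 0 + e 1" and "F = e 0 + e 2"
  define g where "g i = (if i = 1 then e 0 + e 1 + e 2 else e (Suc i))" for i :: nat
  have eL: "e i \<in> L" if "i \<le> Suc N" for i using onb that by (auto simp: onb_def)
  have ee: "B (e i) (e j) = (if i = j then eta i else 0)" if "i \<le> Suc N" "j \<le> Suc N" for i j
    using onb that by (auto simp: onb_def orthonormal_def)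
  have nd: "x = 0" if "x \<in> L" "\<And>i. i \<le> Suc N \<Longrightarrow> B x (e i) = 0" for x
    using onb that by (auto simp: onb_def)
  have EL: "E \<in> L" "F \<in> L" using N eL by (auto simp: E_def F_def intro!: uni_add[OF L])
  have gL: "g i \<in> L" if "i \<in> {1..N}" for i
    using that N eL by (auto simp: g_def intro!: uni_add[OF L])
  have B1: "B E E = 0" "B F F = 0" "B E F = 1" "B F E = 1"
    using N by (auto simp: E_def F_def ee eta_def)
  have B2: "B E (g i) = 0" "B F (g i) = 0" "B (g i) E = 0" "B (g i) F = 0" if "i \<in> {1..N}" for i
    using N that by (auto simp: E_def F_def g_def ee eta_def)
  have B3: "B (g i) (g j) = (if i = j then - 1 else 0)" if "i \<in> {1..N}" "j \<in> {1..N}" for i j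
    using N that by (auto simp: g_def ee eta_def)
  have "x = B x F *\<^sub>R E + B x E *\<^sub>R F - (\<Sum>i = 1..N. B x (g i) *\<^sub>R g i)" if x: "x \<in> L" for x
  proof -
    define D where "D = x - (B x F *\<^sub>R E + B x E *\<^sub>R F - (\<Sum>i = 1..N. B x (g i) *\<^sub>R g i))"
    have DL: "D \<in> L" unfolding D_def
      by (intro uni_diff[OF L] uni_add[OF L] uni_sum[OF L] uni_scale[OF L] uni_Ints[OF L] EL gL x)
    have DE: "B D E = 0" "B D F = 0"
      using B1 B2 by (auto simp: D_def B_sum_left)
    have Dg: "B D (g j) = 0" if j: "j \<in> {1..N}" for j
    proof -
      have "(\<Sum>i = 1..N. B x (g i) * B (g i) (g j)) = (\<Sum>i = 1..N. if i = j then - B x (g j) else 0)"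
        using B3 j by (intro sum.cong) auto
      then show ?thesis using B2 j by (simp add: D_def B_sum_left)
    qed
    have "B D (e 0 + e 1 + e 2) = 0" using Dg[of 1] N by (simp add: g_def)
    then have *: "B D (e 0) = 0" "B D (e 1) = 0" "B D (e 2) = 0"
      using DE by (auto simp: E_def F_def)
    have "D = 0"
    proof (rule nd[OF DL])
      fix i assume i: "i \<le> Suc N"
      consider "i = 0" | "i = 1" | "i = 2" | "i \<ge> 3" by linarith
      then show "B D (e i) = 0"
      proof cases
        case 4
        then have "e i = g (i - 1)" by (auto simp: g_def)
        moreover have "i - 1 \<in> {1..N}" using i 4 by auto
        ultimately show ?thesis using Dg by metis
      qed (use * in auto)
    qed
    then show ?thesis by (simp add: D_def)
  qed
  then have "hyperbolic_basis L N E F g"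
    unfolding hyperbolic_basis_def using EL gL B1 B2 B3 by blast
  then show ?thesis by blast
qed

text \<open>Up to a scalar, the vector \<open>z\<close> is the image of \<open>z0 = F + 2 y + 2 \<bar>y\<bar>\<^sup>2 E\<close> under
  the reflection that exchanges \<open>u\<close> with a vector \<open>v\<close> of the same norm orthogonal to \<open>z0\<close>; the vector \<open>y\<close> is chosen
  such that \<open>u \<cdot> z0 / 2\<close> is prime to \<open>2 m\<close>.\<close>

lemma isotropic_vector:
  assumes L: "unimodular L" and hb: "hyperbolic_basis L N E F g"
    and m: "1 \<le> m" "m \<le> N" and u: "characteristic L u" "B u u = - real m"
    and prim: "x1 \<in> L" "B u x1 = 1"
  shows "\<exists>z\<in>L. z \<noteq> 0 \<and> B z z = 0 \<and> B z u = 0 \<and>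
    (\<forall>p l x. prime (p::int) \<longrightarrow> p dvd int m \<longrightarrow> (p = 2 \<longrightarrow> 8 \<le> m) \<longrightarrow> x \<in> L \<longrightarrow>
       z \<noteq> of_int l *\<^sub>R u + of_int p *\<^sub>R x)"
proof -
  have EF: "E \<in> L" "F \<in> L" and gL: "\<And>i. i \<in> {1..N} \<Longrightarrow> g i \<in> L"
    and B1: "B E E = 0" "B F F = 0" "B E F = 1" "B F E = 1"
    and B2: "\<And>i. i \<in> {1..N} \<Longrightarrow> B E (g i) = 0" "\<And>i. i \<in> {1..N} \<Longrightarrow> B F (g i) = 0"
    and B3: "\<And>i j. i \<in> {1..N} \<Longrightarrow> j \<in> {1..N} \<Longrightarrow> B (g i) (g j) = (if i = j then - 1 else 0)"
    and ex: "\<And>x. x \<in> L \<Longrightarrow> x = B x F *\<^sub>R E + B x E *\<^sub>R F - (\<Sum>i = 1..N. B x (g i) *\<^sub>R g i)"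
    using hb B_sym[of F E] unfolding hyperbolic_basis_def by auto
  have B2': "B (g i) E = 0" "B (g i) F = 0" if "i \<in> {1..N}" for i
    using B2[OF that] by (simp_all add: B_sym[of "g i" E] B_sym[of "g i" F])
  have uL: "u \<in> L" and char: "\<And>x. x \<in> L \<Longrightarrow> even_real (B u x - B x x)"
    using u by (auto simp: characteristic_def)
  \<comment> \<open>Characteristic vectors have even product with the isotropic \<open>F\<close> and
    \<open>E\<close>, and odd product with each \<open>g i\<close>.\<close>
  obtain \<alpha> :: int where \<alpha>: "B u F = 2 * of_int \<alpha>" using char[OF EF(2)] B1 by (auto simp: even_real_def)
  obtain \<beta> :: int where \<beta>: "B u E = 2 * of_int \<beta>" using char[OF EF(1)] B1 by (auto simp: even_real_def)
  have "\<forall>i. \<exists>k::int. i \<in> {1..N} \<longrightarrow> B u (g i) = of_int k"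
    using uni_Ints[OF L uL gL] by (metis Ints_cases)
  then obtain k :: "nat \<Rightarrow> int" where k: "\<And>i. i \<in> {1..N} \<Longrightarrow> B u (g i) = of_int (k i)" by metis
  have kodd: "odd (k i)" if "i \<in> {1..N}" for i
  proof -
    have "even_real (B u (g i) - B (g i) (g i))" by (rule char[OF gL[OF that]])
    then have "even_real (of_int (k i + 1))" using k[OF that] B3[OF that that] by simp
    then show ?thesis by (simp only: even_real_iff) simp
  qed
  have N1: "N \<ge> 1" using m by simp
  have "\<exists>y. \<forall>p. prime p \<and> p dvd 2 * int m \<longrightarrow>
    \<not> p dvd \<alpha> + (\<Sum>i = 1..N. y i * k i) + 2 * \<beta> * (\<Sum>i = 1..N. y i * y i)"
  proof (rule quadratic_coprime_value[OF N1 kodd])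
    show "2 * int m \<noteq> 0" using m by simp
    \<comment> \<open>Such a prime would divide \<open>B u x1 = 1\<close>.\<close>
    fix p :: int assume p: "prime p" "p dvd \<alpha>" "p dvd \<beta>" and pk: "\<And>i. i \<in> {1..N} \<Longrightarrow> p dvd k i"
    obtain a where a: "B x1 F = of_int a" by (rule uni_int[OF L prim(1) EF(2)])
    obtain b where b: "B x1 E = of_int b" by (rule uni_int[OF L prim(1) EF(1)])
    have "\<forall>i. \<exists>c::int. i \<in> {1..N} \<longrightarrow> B x1 (g i) = of_int c"
      using uni_Ints[OF L prim(1) gL] by (metis Ints_cases)
    then obtain c :: "nat \<Rightarrow> int" where c: "\<And>i. i \<in> {1..N} \<Longrightarrow> B x1 (g i) = of_int (c i)" by metis
    have "B u x1 = B u (B x1 F *\<^sub>R E + B x1 E *\<^sub>R F - (\<Sum>i = 1..N. B x1 (g i) *\<^sub>R g i))"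
      using ex[OF prim(1)] by simp
    also have "\<dots> = of_int (a * (2 * \<beta>) + b * (2 * \<alpha>) - (\<Sum>i = 1..N. c i * k i))"
      using a b c k \<alpha> \<beta> by (simp add: B_sum_right)
    finally have "1 = a * (2 * \<beta>) + b * (2 * \<alpha>) - (\<Sum>i = 1..N. c i * k i)"
      using prim(2) by (simp only: of_int_eq_1_iff)
    moreover have "p dvd a * (2 * \<beta>) + b * (2 * \<alpha>) - (\<Sum>i = 1..N. c i * k i)"
      using p pk by (intro dvd_diff dvd_add dvd_sum dvd_mult) auto
    ultimately show False using p(1) by (metis not_prime_unit)
  qed (use k in auto)
  then obtain yc where yc: "\<And>p. prime p \<Longrightarrow> p dvd 2 * int m \<Longrightarrow>
    \<not> p dvd \<alpha> + (\<Sum>i = 1..N. yc i * k i) + 2 * \<beta> * (\<Sum>i = 1..N. yc i * yc i)" by blast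
  obtain c where c: "(\<Sum>i = 1..N. c i * c i) = int m" "\<exists>i\<in>{1..N}. c i = 1"
    "8 \<le> m \<Longrightarrow> \<exists>i\<in>{1..N}. even (c i)"
    using sum_of_squares_vector[OF m] by blast
  define S1 S2 C where "S1 = (\<Sum>i = 1..N. yc i * k i)" and "S2 = (\<Sum>i = 1..N. yc i * yc i)"
    and "C = (\<Sum>i = 1..N. c i * yc i)"
  define \<zeta> where "\<zeta> = \<alpha> + S1 + 2 * \<beta> * S2"
  have \<zeta>: "\<not> p dvd \<zeta>" if "prime p" "p dvd 2 * int m" for p
    using yc[OF that] by (simp add: \<zeta>_def S1_def S2_def)
  have \<zeta>0: "\<zeta> \<noteq> 0" using \<zeta>[of 2] by auto
  define y v0 where "y = (\<Sum>i = 1..N. of_int (yc i) *\<^sub>R g i)" and "v0 = (\<Sum>i = 1..N. of_int (c i) *\<^sub>R g i)"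
  have yL: "y \<in> L" "v0 \<in> L" by (auto simp: y_def v0_def intro!: uni_sum[OF L] uni_scale[OF L] gL)
  have comb: "B (\<Sum>i = 1..N. of_int (a i) *\<^sub>R g i) (g j) = - of_int (a j)" if "j \<in> {1..N}" for a j
  proof -
    have "(\<Sum>i = 1..N. of_int (a i) * B (g i) (g j)) = (\<Sum>i = 1..N. if i = j then - of_int (a j) else 0)"
      using B3 that by (intro sum.cong) auto
    then show ?thesis using that by (simp add: B_sum_left)
  qed
  have yg: "B y (g j) = - of_int (yc j)" "B v0 (g j) = - of_int (c j)" if "j \<in> {1..N}" for j
    unfolding y_def v0_def using comb[OF that] by auto
  have yE: "B y E = 0" "B y F = 0" "B v0 E = 0" "B v0 F = 0"
    "B E y = 0" "B F y = 0" "B E v0 = 0" "B F v0 = 0"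
    using B2 B2' by (simp_all add: y_def v0_def B_sum_left B_sum_right)
  have yy: "B y y = - of_int S2" "B v0 y = - of_int C" "B y v0 = - of_int C" "B v0 v0 = - real m"
    "B u y = of_int S1"
  proof -
    have "B y y = (\<Sum>i = 1..N. of_int (yc i) * B y (g i))" by (subst (2) y_def) (simp add: B_sum_right)
    then show "B y y = - of_int S2" using yg by (simp add: S2_def sum_negf)
    have "B v0 y = (\<Sum>i = 1..N. of_int (yc i) * B v0 (g i))" by (subst y_def) (simp add: B_sum_right)
    then show C: "B v0 y = - of_int C" using yg by (simp add: C_def sum_negf mult.commute)
    then show "B y v0 = - of_int C" by (simp add: B_sym[of y v0])
    have "B v0 v0 = (\<Sum>i = 1..N. of_int (c i) * B v0 (g i))" by (subst (2) v0_def) (simp add: B_sum_right)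
    then have "B v0 v0 = - of_int (\<Sum>i = 1..N. c i * c i)" using yg by (simp add: sum_negf)
    then show "B v0 v0 = - real m" by (simp only: c(1) of_int_of_nat_eq)
    have "B u y = (\<Sum>i = 1..N. of_int (yc i) * B u (g i))" by (subst y_def) (simp add: B_sum_right)
    then show "B u y = of_int S1" using k by (simp add: S1_def)
  qed
  define z0 where "z0 = F + 2 *\<^sub>R y + (2 * of_int S2) *\<^sub>R E"
  \<comment> \<open>The multiple of \<open>E\<close> makes \<open>v\<close> orthogonal to
    \<open>z0\<close>; the norm remains that of \<open>v0\<close>, namely
    \<open>- m\<close>.\<close>
  define v where "v = v0 + (2 * of_int C) *\<^sub>R E"
  have z0L: "z0 \<in> L" unfolding z0_def
    by (intro uni_add[OF L] uni_scale[OF L] yL EF) auto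
  have vL: "v \<in> L" unfolding v_def
    by (intro uni_add[OF L] uni_scale[OF L] yL EF) auto
  have z0z0: "B z0 z0 = 0" using B1 yE yy by (simp add: z0_def)
  have vz0: "B v z0 = 0" "B z0 v = 0" using B1 yE yy by (simp_all add: z0_def v_def)
  have vv: "B v v = - real m" using B1 yE yy by (simp add: v_def)
  have uz0: "B u z0 = 2 * of_int \<zeta>" "B z0 u = 2 * of_int \<zeta>"
    using \<alpha> \<beta> yy by (simp_all add: z0_def \<zeta>_def B_sym[of _ u] algebra_simps)
  have vE: "B v E = 0" "B z0 E = 1" using B1 yE by (simp_all add: z0_def v_def)
  have vg: "B v (g i) = - of_int (c i)" "B z0 (g i) = - 2 * of_int (yc i)" if "i \<in> {1..N}" for i
    using B2 yg that by (simp_all add: z0_def v_def)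
  \<comment> \<open>Hence \<open>u - v\<close> has norm -4 \<mu>.\<close>
  have "even_real (B u v - B v v)" by (rule char[OF vL])
  then obtain \<mu> :: int where "B u v + real m = 2 * of_int \<mu>" using vv by (auto simp: even_real_def)
  then have \<mu>: "B u v = 2 * of_int \<mu> - real m" by simp
  then have \<mu>': "B v u = 2 * of_int \<mu> - real m" by (simp add: B_sym[of v u])
  \<comment> \<open>As \<open>u - v\<close> has norm -4 \<mu> and product 2 \<zeta> with
    \<open>z0\<close>, this is \<mu> times the reflected \<open>z0\<close>. The formula keeps its
    properties when \<mu> = 0.\<close>
  define z where "z = of_int \<mu> *\<^sub>R z0 + of_int \<zeta> *\<^sub>R (u - v)"
  have zL: "z \<in> L" unfolding z_def
    by (intro uni_add[OF L] uni_scale[OF L] uni_diff[OF L] z0L uL vL) auto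
  have zu: "B z u = 0" by (simp add: z_def u(2) uz0 \<mu>' algebra_simps)
  have zz: "B z z = 0" by (simp add: z_def u(2) uz0 \<mu> \<mu>' vv vz0 z0z0 algebra_simps)
  have "B z z0 = 2 * of_int \<zeta> * of_int \<zeta>" using z0z0 uz0 vz0 by (simp add: z_def)
  then have z0: "z \<noteq> 0" using \<zeta>0 by auto
  \<comment> \<open>Compare products modulo \<open>p\<close> with \<open>E\<close>,
    \<open>z0\<close> and the \<open>g i\<close>. For odd \<open>p\<close> they give in turn that
    \<open>l\<close> is congruent to \<zeta>, that \<open>p\<close> divides \<mu>, and that
    \<open>p\<close> divides every \<zeta> \<open>c i\<close>, although some \<open>c i\<close> is
    1. For \<open>p = 2\<close> all \<open>c i\<close> would have the parity of the odd number
    \<zeta> - \<open>l\<close> times \<open>k i\<close> or all be even, against the mixed parities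
    of \<open>c\<close>.\<close>
  have indep: False if p: "prime p" "p dvd int m" "p = 2 \<longrightarrow> 8 \<le> m" and x: "x \<in> L"
    and eq: "z = of_int l *\<^sub>R u + of_int p *\<^sub>R x" for p l x
  proof -
    have Bx: "B z w = of_int l * B u w + of_int p * B x w" for w by (simp add: eq)
    have p\<zeta>: "\<not> p dvd \<zeta>" using \<zeta>[OF p(1)] p(2) by simp
    obtain a where a: "B x E = of_int a" by (rule uni_int[OF L x EF(1)])
    have "of_int (\<mu> + 2 * \<beta> * (\<zeta> - l)) = (of_int (p * a) :: real)"
      using Bx[of E] a \<beta> vE by (simp add: z_def algebra_simps)
    then have 1: "\<mu> + 2 * \<beta> * (\<zeta> - l) = p * a" by (simp only: of_int_eq_iff)
    obtain b where b: "B x z0 = of_int b" by (rule uni_int[OF L x z0L])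
    have "of_int (2 * \<zeta> * (\<zeta> - l)) = (of_int (p * b) :: real)"
      using Bx[of z0] b uz0 vz0 z0z0 by (simp add: z_def algebra_simps)
    then have 2: "2 * \<zeta> * (\<zeta> - l) = p * b" by (simp only: of_int_eq_iff)
    have 3: "p dvd - 2 * \<mu> * yc i + (\<zeta> - l) * k i + \<zeta> * c i" if i: "i \<in> {1..N}" for i
    proof -
      obtain d where d: "B x (g i) = of_int d" by (rule uni_int[OF L x gL[OF i]])
      have "of_int (- 2 * \<mu> * yc i + (\<zeta> - l) * k i + \<zeta> * c i) = (of_int (p * d) :: real)"
        using Bx[of "g i"] d k[OF i] vg[OF i] by (simp add: z_def algebra_simps)
      then have "- 2 * \<mu> * yc i + (\<zeta> - l) * k i + \<zeta> * c i = p * d" by (simp only: of_int_eq_iff)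
      then show ?thesis by simp
    qed
    obtain i where i: "i \<in> {1..N}" "c i = 1" using c(2) by blast
    show False
    proof (cases "p = 2")
      case True
      then obtain j where j: "j \<in> {1..N}" "even (c j)" using c(3) p(3) by blast
      have "odd \<zeta>" using p\<zeta> True by simp
      then show False using 3[OF i(1)] 3[OF j(1)] kodd[OF i(1)] kodd[OF j(1)] i(2) j(2) True by auto
    next
      case False
      have "p > 2" using prime_ge_2_int[OF p(1)] False by simp
      then have "\<not> p dvd 2" using zdvd_imp_le[of p 2] by auto
      moreover have "p dvd 2 * \<zeta> * (\<zeta> - l)" using 2 by simp
      ultimately have d: "p dvd \<zeta> - l" using p\<zeta> p(1) by (simp add: prime_dvd_mult_iff)
      have "p dvd \<mu> + 2 * \<beta> * (\<zeta> - l)" using 1 by simp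
      then have "p dvd \<mu>" using d by (simp add: dvd_add_left_iff)
      then have "p dvd - 2 * \<mu> * yc i + (\<zeta> - l) * k i" using d by auto
      then have "p dvd \<zeta> * c i" using 3[OF i(1)] by (simp add: dvd_add_right_iff)
      then show False using i(2) p\<zeta> by simp
    qed
  qed
  show ?thesis using zL z0 zz zu indep by (intro bexI[of _ z]) blast+
qed

text \<open>The primitive \<open>z\<close> proportional to the vector of
  \<open>isotropic_vector\<close> is orthogonal to \<open>u\<close>; its values on the complement of
  \<open>u\<close> form a subgroup generated by \<open>h\<close>. A prime dividing \<open>h\<close>
  would make \<open>z\<close> congruent to a multiple of \<open>u\<close> modulo that prime, which
  the choice of the vector excludes, except for 2 with \<open>m < 8\<close>; that case is refuted by
  a computation modulo 8.\<close>

lemma isotropic_pair: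
  assumes L: "unimodular L" and onb: "onb L n e" and m: "1 \<le> m" "m < n"
    and u: "characteristic L u" "B u u = - real m" and prim: "x1 \<in> L" "B u x1 = 1"
  shows "\<exists>z\<in>L. \<exists>w\<in>L. B z u = 0 \<and> B w u = 0 \<and> B z z = 0 \<and> B z w = 1"
proof -
  obtain N where N: "n = Suc N" "m \<le> N" using m by (cases n) auto
  obtain E F g where hb: "hyperbolic_basis L N E F g"
    using onb_hyperbolic_basis[OF L onb[unfolded N]] N m by auto
  obtain z0 where z0: "z0 \<in> L" "z0 \<noteq> 0" "B z0 z0 = 0" "B z0 u = 0"
    and ind: "\<And>p l x. prime (p::int) \<Longrightarrow> p dvd int m \<Longrightarrow> (p = 2 \<Longrightarrow> 8 \<le> m) \<Longrightarrow> x \<in> L \<Longrightarrow>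
       z0 \<noteq> of_int l *\<^sub>R u + of_int p *\<^sub>R x"
    using isotropic_vector[OF L hb m(1) N(2) u prim] by blast
  obtain c :: int and z w where z: "z \<in> L" "w \<in> L" "z0 = of_int c *\<^sub>R z" "B z w = 1"
    using primitive_multiple[OF L z0(1,2)] by blast
  have "c \<noteq> 0" using z z0 by auto
  then have zz: "B z z = 0" and zu: "B z u = 0" using z z0 by auto
  have uL: "u \<in> L" and char: "\<And>x. x \<in> L \<Longrightarrow> even_real (B u x - B x x)"
    using u by (auto simp: characteristic_def)
  define S where "S = {k::int. \<exists>x\<in>L. B x u = 0 \<and> B z x = of_int k}"
  have "\<exists>g\<in>S. \<forall>a\<in>S. g dvd a"
  proof (rule int_subgroup_generator)
    have "0 \<in> S" unfolding S_def using uni_zero[OF L] by (auto intro!: bexI[of _ 0])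
    then show "S \<noteq> {}" by auto
    show "a + b \<in> S" if "a \<in> S" "b \<in> S" for a b
    proof -
      from that obtain x y where "x \<in> L" "y \<in> L" "B x u = 0" "B y u = 0"
        "B z x = of_int a" "B z y = of_int b" by (auto simp: S_def)
      then show ?thesis unfolding S_def by (auto intro!: bexI[of _ "x + y"] uni_add[OF L])
    qed
    show "- a \<in> S" if "a \<in> S" for a
    proof -
      from that obtain x where "x \<in> L" "B x u = 0" "B z x = of_int a" by (auto simp: S_def)
      then show ?thesis unfolding S_def by (auto intro!: bexI[of _ "- x"] uni_minus[OF L])
    qed
  qed
  then obtain h where h: "h \<in> S" "\<And>a. a \<in> S \<Longrightarrow> h dvd a" by blast
  have "is_unit h"
  proof (rule ccontr)
    assume "\<not> is_unit h"
    \<comment> \<open>The case \<open>h = 0\<close> is included; there the prime 2 serves.\<close>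
    then obtain p where p: "prime p" "p dvd h" using prime_divisor_exists[of h]
      by (metis dvd_0_right two_is_prime_nat prime_int_numeral_eq)
    obtain s where s: "B z x1 = of_int s" by (rule uni_int[OF L z(1) prim(1)])
    \<comment> \<open>Subtracting \<open>B u x\<close> times \<open>x1\<close> moves
      \<open>x\<close> into the complement of \<open>u\<close>, where \<open>p\<close> divides all
      values of \<open>B z\<close>.\<close>
    have "B (z - of_int s *\<^sub>R u) x / of_int p \<in> \<int>" if x: "x \<in> L" for x
    proof -
      obtain a where a: "B u x = of_int a" by (rule uni_int[OF L uL x])
      obtain b where b: "B z x = of_int b" by (rule uni_int[OF L z(1) x])
      have "b - a * s \<in> S"
        unfolding S_def
      proof (intro CollectI bexI conjI)
        show "x - of_int a *\<^sub>R x1 \<in> L" by (intro uni_diff[OF L] uni_scale[OF L] x prim) auto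
        show "B (x - of_int a *\<^sub>R x1) u = 0" using a prim by (simp add: B_sym[of _ u])
        show "B z (x - of_int a *\<^sub>R x1) = of_int (b - a * s)" using b s by simp
      qed
      then obtain q where "b - a * s = p * q" using h(2) p(2) by (meson dvd_trans dvdE)
      moreover have "B (z - of_int s *\<^sub>R u) x = of_int (b - a * s)" using a b by simp
      ultimately show ?thesis using p(1) by simp
    qed
    moreover have "z - of_int s *\<^sub>R u \<in> L" by (intro uni_diff[OF L] uni_scale[OF L] z uL) auto
    moreover have "p \<noteq> 0" using p(1) by auto
    ultimately obtain y where y: "y \<in> L" "z - of_int s *\<^sub>R u = of_int p *\<^sub>R y"
      using uni_divide[OF L] by blast
    then have zs: "z = of_int s *\<^sub>R u + of_int p *\<^sub>R y" by (simp add: algebra_simps)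
    have ps: "\<not> p dvd s"
    proof
      assume "p dvd s"
      obtain a where a: "B u w = of_int a" by (rule uni_int[OF L uL z(2)])
      obtain b where b: "B y w = of_int b" by (rule uni_int[OF L y(1) z(2)])
      have "of_int (s * a + p * b) = (1::real)" using z(4) a b by (simp add: zs)
      then have "s * a + p * b = 1" by (simp only: of_int_eq_1_iff)
      then have "p dvd 1" using \<open>p dvd s\<close> by (metis dvd_add dvd_mult2 dvd_triv_left)
      then show False using p(1) by (simp add: not_prime_unit)
    qed
    obtain t where t: "B y u = of_int t" by (rule uni_int[OF L y(1) uL])
    have "of_int (p * t) = (of_int (s * int m) :: real)" using zu t u(2) by (simp add: zs)
    then have pt: "p * t = s * int m" by (simp only: of_int_eq_iff)
    then have pm: "p dvd int m" using ps p(1) by (metis dvd_triv_left prime_dvd_multD)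
    have "z0 = of_int (c * s) *\<^sub>R u + of_int p *\<^sub>R (of_int c *\<^sub>R y)"
      by (subst z(3), subst zs) (simp add: algebra_simps)
    moreover have "of_int c *\<^sub>R y \<in> L" by (intro uni_scale[OF L] y) auto
    ultimately have p2: "p = 2" and m8: "\<not> 8 \<le> m" using ind[OF p(1) pm] by blast+
    \<comment> \<open>Now \<open>z\<close> is \<open>s\<close> times \<open>u\<close> plus twice
      \<open>y\<close>, with \<open>s\<close> odd, \<open>2 * t = s * m\<close>,
      \<open>s * t = - 2 * r\<close>, and \<open>t\<close>, \<open>r\<close> of equal parity because
      \<open>u\<close> is characteristic. So \<open>t\<close> is even, then \<open>r\<close> is
      even, then 4 divides \<open>t\<close>, and 8 divides \<open>m\<close>.\<close>
    obtain r where r: "B y y = of_int r" by (rule uni_int[OF L y(1) y(1)])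
    have "B z y = of_int (s * t + 2 * r)" using t r by (simp add: zs p2 B_sym[of u y])
    moreover have "B z z = of_int s * B z u + of_int p * B z y" by (subst (2) zs) simp
    ultimately have "of_int (s * t + 2 * r) = (0::real)" using zz zu p2 by simp
    then have st: "s * t + 2 * r = 0" by (simp only: of_int_eq_0_iff)
    have "even_real (of_int (t - r))" using char[OF y(1)] t r by (simp add: B_sym[of u y])
    then have tr: "even (t - r)" by (simp only: even_real_iff)
    have so: "odd s" using ps p2 by simp
    have "s * t = 2 * (- r)" using st by simp
    then have "even (s * t)" by (metis dvd_triv_left)
    then obtain t' where t': "t = 2 * t'" using so by (auto elim: evenE)
    obtain r' where r': "r = 2 * r'" using tr t' by (auto elim: evenE)
    have "s * t' = - 2 * r'" using st t' r' by simp
    then have "even (s * t')" by simp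
    then obtain t'' where t'': "t' = 2 * t''" using so by (auto elim: evenE)
    have "8 * t'' = s * int m" using pt p2 t' t'' by simp
    then have "8 dvd s * int m" by (metis dvd_triv_left)
    moreover have "coprime (2 ^ 3) s" using so by (subst coprime_power_left_iff) auto
    ultimately have "8 dvd int m" by (simp add: coprime_dvd_mult_right_iff)
    then show False using m8 m(1) zdvd_imp_le[of 8 "int m"] by simp
  qed
  then have "h = 1 \<or> h = - 1" by auto
  moreover obtain x where x: "x \<in> L" "B x u = 0" "B z x = of_int h" using h(1) by (auto simp: S_def)
  ultimately have "B z (of_int h *\<^sub>R x) = 1" "B (of_int h *\<^sub>R x) u = 0" by auto
  moreover have "of_int h *\<^sub>R x \<in> L" by (intro uni_scale[OF L] x) auto
  ultimately show ?thesis using z(1) zz zu by blast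
qed

section \<open>Reduction of the norm\<close>

text \<open>The pairs over which the induction on \<open>m\<close> runs. Primitivity of
  \<open>u\<close> appears as the value 1 of \<open>B u\<close>, the form in which it is
  used.\<close>

definition admissible :: "nat \<Rightarrow> nat \<Rightarrow> 'a set \<Rightarrow> 'a \<Rightarrow> bool" where
  "admissible n m L u \<longleftrightarrow> unimodular L \<and> (\<exists>e. onb L n e) \<and> characteristic L u \<and>
     B u u = - real m \<and> (\<exists>x\<in>L. B u x = 1)"

text \<open>Injectivity is implied on unimodular lattices, since the preserved form is
  nondegenerate.\<close>

definition pair_iso :: "'a set \<Rightarrow> 'a \<Rightarrow> 'a set \<Rightarrow> 'a \<Rightarrow> bool" where
  "pair_iso L1 u1 L2 u2 \<longleftrightarrow> (\<exists>\<phi>. \<phi> ` L1 = L2 \<and> (\<forall>x\<in>L1. \<forall>y\<in>L1. \<phi> (x + y) = \<phi> x + \<phi> y) \<and>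
     (\<forall>x\<in>L1. \<forall>y\<in>L1. B (\<phi> x) (\<phi> y) = B x y) \<and> \<phi> u1 = u2)"

text \<open>A vector \<open>r\<close> of norm -1 with products 1 with \<open>u\<close> and
  \<open>z\<close> makes \<open>u + r\<close> orthogonal to \<open>r\<close>, of norm
  \<open>- m\<close>, and still characteristic on the complement. The single vector
  \<open>z + r\<close> of the complement has norm 1, which makes the complement odd, and product 1
  with \<open>u + r\<close>, which makes \<open>u + r\<close> primitive.\<close>

lemma admissible_reduce:
  assumes ad: "admissible (Suc n) (Suc m) L u" and m: "1 \<le> m" "m < n"
  shows "\<exists>r\<in>L. B r r = - 1 \<and> B u r = 1 \<and> admissible n m (perp L r) (u + r)"
proof -
  obtain e x1 where L: "unimodular L" and onb: "onb L (Suc n) e" and u: "characteristic L u"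
    and uu: "B u u = - real (Suc m)" and x1: "x1 \<in> L" "B u x1 = 1"
    using ad unfolding admissible_def by blast
  have uL: "u \<in> L" and char: "\<And>x. x \<in> L \<Longrightarrow> even_real (B u x - B x x)"
    using u by (auto simp: characteristic_def)
  obtain z w where zw: "z \<in> L" "w \<in> L" "B z u = 0" "B w u = 0" "B z z = 0" "B z w = 1"
    using isotropic_pair[OF L onb _ _ u uu x1] m by auto
  have sym: "B w z = 1" "B u z = 0" "B u w = 0"
    using zw by (simp_all add: B_sym[of w z] B_sym[of u z] B_sym[of u w])
  \<comment> \<open>Correcting by \<open>w\<close> makes \<open>x\<close> orthogonal to
    \<open>z\<close> without changing its product with \<open>u\<close>.\<close>
  define x where "x = x1 - B x1 z *\<^sub>R w"
  have xL: "x \<in> L" unfolding x_def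
    by (intro uni_diff[OF L] uni_scale[OF L] uni_Ints[OF L] x1 zw)
  have x: "B x z = 0" "B u x = 1" using sym x1 by (simp_all add: x_def)
  define r0 where "r0 = x + w"
  have r0L: "r0 \<in> L" unfolding r0_def by (intro uni_add[OF L] xL zw)
  have r0: "B r0 z = 1" "B z r0 = 1" "B u r0 = 1" using x sym by (simp_all add: r0_def B_sym[of z])
  obtain k0 :: int where "1 - B r0 r0 = 2 * of_int k0" using char[OF r0L] r0 by (auto simp: even_real_def)
  then have k0: "B r0 r0 = 1 - 2 * of_int k0" by simp
  \<comment> \<open>The norm of \<open>r0\<close> is odd because its product with \<open>u\<close>
    is 1; subtracting multiples of \<open>z\<close> adjusts it in steps of 2 down or up to
    -1.\<close>
  define r where "r = r0 - of_int (1 - k0) *\<^sub>R z"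
  have rL: "r \<in> L" unfolding r_def by (intro uni_diff[OF L] uni_scale[OF L] r0L zw) auto
  have rr: "B r r = - 1" using k0 r0 zw by (simp add: r_def algebra_simps)
  have ru: "B u r = 1" "B r u = 1" using r0 sym by (simp_all add: r_def B_sym[of _ u])
  have rz: "B r z = 1" "B z r = 1" using r0 zw by (simp_all add: r_def)
  have P: "unimodular (perp L r)" using unimodular_perp[OF L rL rr] by simp
  have y: "z + r \<in> perp L r" using rz rr zw rL by (auto simp: perp_def intro: uni_add[OF L])
  have "B (z + r) (z + r) = 1" using rz rr zw by simp
  then have "odd_real (B (z + r) (z + r))" by (simp add: odd_real_def)
  then have e: "\<exists>e. onb (perp L r) n e"
    using odd_unimodular_onb[OF P frame_perp[OF L onb_imp_frame[OF onb] rL rr] y] by blast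
  have "u + r \<in> perp L r" using uL rL ru rr by (auto simp: perp_def intro: uni_add[OF L])
  moreover have "B (u + r) x = B u x" if "x \<in> perp L r" for x
    using that B_sym[of r x] by (simp add: perp_def)
  ultimately have "characteristic (perp L r) (u + r)"
    using char by (auto simp: characteristic_def perp_def)
  moreover have "B (u + r) (u + r) = - real m" using uu ru rr by simp
  moreover have "B (u + r) (z + r) = 1" using ru rr rz sym by simp
  ultimately have "admissible n m (perp L r) (u + r)"
    unfolding admissible_def using P e y by blast
  then show ?thesis using rL rr ru by blast
qed

text \<open>Each lattice is the orthogonal sum of the complement and the multiples of a vector of
  norm -1, so the isometry extends by sending \<open>r1\<close> to \<open>r2\<close>. The vector
  \<open>y + c r1\<close> covers both applications: \<open>y = 0\<close>, \<open>c = 1\<close> for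
  \<open>m = 1\<close>, and \<open>y = u + r\<close>, \<open>c = - 1\<close> in the induction
  step.\<close>

lemma perp_isometry_extend:
  assumes L1: "unimodular L1" and L2: "unimodular L2" and r1: "r1 \<in> L1" "B r1 r1 = - 1"
    and r2: "r2 \<in> L2" "B r2 r2 = - 1"
    and im: "\<phi> ` perp L1 r1 = perp L2 r2"
    and add: "\<And>x y. x \<in> perp L1 r1 \<Longrightarrow> y \<in> perp L1 r1 \<Longrightarrow> \<phi> (x + y) = \<phi> x + \<phi> y"
    and iso: "\<And>x y. x \<in> perp L1 r1 \<Longrightarrow> y \<in> perp L1 r1 \<Longrightarrow> B (\<phi> x) (\<phi> y) = B x y"
    and y: "y \<in> perp L1 r1" and c: "c \<in> \<int>"
  shows "pair_iso L1 (y + c *\<^sub>R r1) L2 (\<phi> y + c *\<^sub>R r2)"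
proof -
  define pr where "pr x = x + B x r1 *\<^sub>R r1" for x
  define \<psi> where "\<psi> x = \<phi> (pr x) - B x r1 *\<^sub>R r2" for x
  have pr: "pr x \<in> perp L1 r1" if "x \<in> L1" for x
    using that r1 uni_Ints[OF L1 that r1(1)]
    by (auto simp: pr_def perp_def intro!: uni_add[OF L1] uni_scale[OF L1])
  have pr_add: "pr (a + b) = pr a + pr b" for a b by (simp add: pr_def algebra_simps)
  have \<psi>: "\<psi> (y + c *\<^sub>R r1) = \<phi> y + c *\<^sub>R r2" if "y \<in> perp L1 r1" for y c
  proof -
    have "B (y + c *\<^sub>R r1) r1 = - c" using that r1 by (simp add: perp_def)
    then show ?thesis by (simp add: \<psi>_def pr_def)
  qed
  have dec: "x = pr x + (- B x r1) *\<^sub>R r1" for x by (simp add: pr_def)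
  have "\<psi> ` L1 = L2"
  proof (intro equalityI subsetI)
    fix x assume "x \<in> \<psi> ` L1"
    then obtain a where a: "a \<in> L1" "x = \<psi> a" by blast
    have "\<phi> (pr a) \<in> perp L2 r2" using pr[OF a(1)] im by blast
    then have "\<phi> (pr a) \<in> L2" by (simp add: perp_def)
    then show "x \<in> L2" unfolding a(2) \<psi>_def
      by (intro uni_diff[OF L2] uni_scale[OF L2] uni_Ints[OF L1] a r1 r2)
  next
    fix x assume x: "x \<in> L2"
    have int: "B x r2 \<in> \<int>" by (rule uni_Ints[OF L2 x r2(1)])
    have "x + B x r2 *\<^sub>R r2 \<in> perp L2 r2"
      using x r2 int by (auto simp: perp_def intro!: uni_add[OF L2] uni_scale[OF L2])
    then obtain y where y: "y \<in> perp L1 r1" "\<phi> y = x + B x r2 *\<^sub>R r2" using im by (metis imageE)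
    have "\<psi> (y + (- B x r2) *\<^sub>R r1) = x"
      using \<psi>[OF y(1), of "- B x r2"] y(2) by (simp del: scaleR_minus_left) simp
    moreover have "y + (- B x r2) *\<^sub>R r1 \<in> L1"
      by (intro uni_add[OF L1] uni_scale[OF L1] r1) (use y int in \<open>auto simp: perp_def\<close>)
    ultimately show "x \<in> \<psi> ` L1" by (metis imageI)
  qed
  moreover have "\<psi> (a + b) = \<psi> a + \<psi> b" if "a \<in> L1" "b \<in> L1" for a b
    using add[OF pr[OF that(1)] pr[OF that(2)]] by (simp add: \<psi>_def pr_add algebra_simps)
  moreover have "B (\<psi> a) (\<psi> b) = B a b" if ab: "a \<in> L1" "b \<in> L1" for a b
  proof -
    have "\<phi> (pr a) \<in> perp L2 r2" "\<phi> (pr b) \<in> perp L2 r2"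
      using pr[OF ab(1)] pr[OF ab(2)] im by blast+
    then have o: "B (\<phi> (pr a)) r2 = 0" "B r2 (\<phi> (pr b)) = 0"
      using B_sym[of r2 "\<phi> (pr b)"] by (auto simp: perp_def)
    have "B (\<psi> a) (\<psi> b) = B (pr a) (pr b) - B a r1 * B b r1"
      using o r2 iso[OF pr[OF ab(1)] pr[OF ab(2)]] by (simp add: \<psi>_def)
    also have "\<dots> = B a b" using r1 by (simp add: pr_def B_sym[of r1 b])
    finally show ?thesis .
  qed
  ultimately show ?thesis
    unfolding pair_iso_def by (intro exI[of _ \<psi>] conjI ballI \<psi>[OF y]) auto
qed

section \<open>Coordinates in orthonormal families, and the lattice D^+\<close>

definition lin :: "nat \<Rightarrow> (nat \<Rightarrow> 'a) \<Rightarrow> (nat \<Rightarrow> real) \<Rightarrow> 'a" where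
  "lin k e s = (\<Sum>i\<le>k. s i *\<^sub>R e i)"

text \<open>The lattice D^+ of rank \<open>k + 1\<close>: the integer points with even coordinate
  sum, and their translate by the vector with all coordinates 1/2.\<close>

definition dplus_coords :: "nat \<Rightarrow> (nat \<Rightarrow> real) set" where
  "dplus_coords k = {s. \<exists>t::nat \<Rightarrow> int. even (\<Sum>i\<le>k. t i) \<and>
     ((\<forall>i\<le>k. s i = of_int (t i)) \<or> (\<forall>i\<le>k. s i = of_int (t i) + 1 / 2))}"

lemma lin_cong: "(\<And>i. i \<le> k \<Longrightarrow> s i = t i) \<Longrightarrow> lin k e s = lin k e t"
  by (simp add: lin_def)

lemma lin_add: "lin k e s + lin k e t = lin k e (\<lambda>i. s i + t i)"
  by (simp add: lin_def sum.distrib scaleR_add_left)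

lemma B_lin_basis:
  assumes "orthonormal k e" "j \<le> k"
  shows "B (lin k e s) (e j) = eta j * s j" "B (e j) (lin k e s) = eta j * s j"
proof -
  have "B (lin k e s) (e j) = (\<Sum>i\<le>k. if i = j then eta j * s j else 0)"
    unfolding lin_def B_sum_left using assms
    by (intro sum.cong) (auto simp: orthonormal_def)
  then show "B (lin k e s) (e j) = eta j * s j" using assms(2) by simp
  then show "B (e j) (lin k e s) = eta j * s j" by (simp add: B_sym[of "e j"])
qed

lemma B_lin_lin:
  assumes "orthonormal k e"
  shows "B (lin k e s) (lin k e t) = (\<Sum>i\<le>k. eta i * s i * t i)"
proof -
  have "B (lin k e s) (lin k e t) = (\<Sum>i\<le>k. t i * B (lin k e s) (e i))"
    by (subst (2) lin_def) (simp add: B_sum_right)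
  also have "\<dots> = (\<Sum>i\<le>k. eta i * s i * t i)"
    by (intro sum.cong) (use B_lin_basis[OF assms] in auto)
  finally show ?thesis .
qed

lemma lin_mem: "unimodular L \<Longrightarrow> (\<And>i. i \<le> k \<Longrightarrow> e i \<in> L) \<Longrightarrow> (\<And>i. i \<le> k \<Longrightarrow> s i \<in> \<int>) \<Longrightarrow> lin k e s \<in> L"
  unfolding lin_def by (intro uni_sum uni_scale) auto

text \<open>The map keeps coordinates, which are read off by products with the \<open>e1 i\<close>;
  norms and products depend on coordinates alone.\<close>

lemma lin_isometry:
  assumes e1: "orthonormal k e1" and e2: "orthonormal k e2"
  shows "\<exists>\<phi>. \<phi> ` lin k e1 ` P = lin k e2 ` P \<and> (\<forall>x y. \<phi> (x + y) = \<phi> x + \<phi> y) \<and>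
     (\<forall>x\<in>lin k e1 ` P. \<forall>y\<in>lin k e1 ` P. B (\<phi> x) (\<phi> y) = B x y)"
proof -
  define \<phi> where "\<phi> x = lin k e2 (\<lambda>i. eta i * B x (e1 i))" for x
  have \<phi>: "\<phi> (lin k e1 s) = lin k e2 s" for s
    unfolding \<phi>_def by (rule lin_cong) (simp add: B_lin_basis[OF e1])
  have "\<phi> ` lin k e1 ` P = lin k e2 ` P" by (simp add: image_image \<phi>)
  moreover have "\<phi> (x + y) = \<phi> x + \<phi> y" for x y
    by (simp add: \<phi>_def lin_add algebra_simps)
  moreover have "\<forall>x\<in>lin k e1 ` P. \<forall>y\<in>lin k e1 ` P. B (\<phi> x) (\<phi> y) = B x y"
    by (auto simp: \<phi> B_lin_lin[OF e1] B_lin_lin[OF e2])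
  ultimately show ?thesis by blast
qed

text \<open>Modulo 2 signs are irrelevant and each integer is congruent to its square.\<close>

lemma even_real_lin:
  assumes "orthonormal k e"
  shows "even_real (B (lin k e (\<lambda>i. of_int (t i))) (lin k e (\<lambda>i. of_int (t i)))) \<longleftrightarrow> even (\<Sum>i\<le>k. t i)"
proof -
  define h :: "nat \<Rightarrow> int" where "h i = (if i = 0 then 1 else - 1)" for i
  have h: "eta i = of_int (h i)" for i by (simp add: eta_def h_def)
  have "B (lin k e (\<lambda>i. of_int (t i))) (lin k e (\<lambda>i. of_int (t i))) = of_int (\<Sum>i\<le>k. h i * t i * t i)"
    by (simp add: B_lin_lin[OF assms] h)
  moreover have "even ((\<Sum>i\<le>k. h i * t i * t i) - (\<Sum>i\<le>k. t i))"
    unfolding sum_subtractf[symmetric] by (rule dvd_sum) (auto simp: h_def)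
  ultimately show ?thesis by (simp only: even_real_iff) auto
qed

text \<open>The coefficients are integers, so the difference of the two sides lies in
  \<open>L\<close> and is orthogonal to the basis.\<close>

lemma onb_expand:
  assumes L: "unimodular L" and e: "onb L k e" and x: "x \<in> L"
  shows "x = lin k e (\<lambda>i. eta i * B x (e i))"
proof -
  have eL: "\<And>i. i \<le> k \<Longrightarrow> e i \<in> L" and eo: "orthonormal k e" using e by (auto simp: onb_def)
  have "lin k e (\<lambda>i. eta i * B x (e i)) \<in> L"
    by (rule lin_mem[OF L eL]) (auto simp: eta_def intro!: uni_Ints[OF L x] eL)
  then have "x - lin k e (\<lambda>i. eta i * B x (e i)) \<in> L" by (intro uni_diff[OF L] x)
  moreover have "B (x - lin k e (\<lambda>i. eta i * B x (e i))) (e j) = 0" if "j \<le> k" for j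
    using B_lin_basis[OF eo that] by simp
  ultimately have "x - lin k e (\<lambda>i. eta i * B x (e i)) = 0" using e unfolding onb_def by blast
  then show ?thesis by simp
qed

lemma onb_int_expand:
  assumes L: "unimodular L" and e: "onb L k e" and x: "x \<in> L"
  obtains t :: "nat \<Rightarrow> int" where "x = lin k e (\<lambda>i. of_int (t i))"
proof -
  have "\<forall>i. \<exists>t::int. i \<le> k \<longrightarrow> eta i * B x (e i) = of_int t"
  proof (intro allI)
    fix i
    have "eta i * B x (e i) \<in> \<int>" if "i \<le> k"
      using uni_Ints[OF L x] e that by (auto simp: eta_def onb_def)
    then show "\<exists>t::int. i \<le> k \<longrightarrow> eta i * B x (e i) = of_int t" by (metis Ints_cases)
  qed
  then obtain t :: "nat \<Rightarrow> int" where "\<And>i. i \<le> k \<Longrightarrow> eta i * B x (e i) = of_int (t i)" by metis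
  then have "lin k e (\<lambda>i. eta i * B x (e i)) = lin k e (\<lambda>i. of_int (t i))" by (intro lin_cong)
  then show ?thesis using onb_expand[OF L e x] that by simp
qed

section \<open>Even unimodular lattices and their odd neighbours\<close>

lemma uni_half:
  assumes M: "unimodular M" and v: "2 *\<^sub>R v \<in> M" and i: "\<And>x. x \<in> M \<Longrightarrow> B v x \<in> \<int>"
  shows "v \<in> M"
proof -
  have "\<exists>w\<in>M. 2 *\<^sub>R v = of_int 2 *\<^sub>R w"
    by (rule uni_divide[OF M v]) (use i in auto)
  then show ?thesis by auto
qed

text \<open>Let \<open>M0\<close> consist of the vectors of \<open>M\<close> with even product with
  \<open>z\<close>. Then \<open>M2\<close> is \<open>M0\<close> together with \<open>p + M0\<close>,
  where \<open>p\<close> has norm 1 and \<open>2 p\<close> lies in \<open>M0\<close>. Thus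
  \<open>M2\<close> is odd and \<open>M0\<close> is its even part. Twice either lattice lies in the
  other, so the frame carries over.\<close>

lemma odd_neighbour:
  assumes M: "unimodular M" and ev: "\<And>x. x \<in> M \<Longrightarrow> even_real (B x x)" and fr: "frame M k"
    and zw: "z \<in> M" "w \<in> M" "B z z = 0" "B w w = 0" "B z w = 1" "B w z = 1"
    and p: "p = (1/2) *\<^sub>R z + w"
    and M2: "M2 = {x. \<exists>a\<in>M. \<exists>i::int. even_real (B a z) \<and> x = a + of_int i *\<^sub>R p}"
  shows "unimodular M2" and "\<exists>e. onb M2 k e"
    and "\<And>x. x \<in> M2 \<and> even_real (B x x) \<longleftrightarrow> x \<in> M \<and> even_real (B x z)"
    and "p \<in> M2" and "B w p = 1 / 2" and "\<And>x. x \<in> M2 \<Longrightarrow> 2 *\<^sub>R x \<in> M2"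
proof -
  have pz: "B p z = 1" "B z p = 1" and pw: "B p w = 1/2" "B w p = 1/2" and pp: "B p p = 1"
    using zw by (simp_all add: p)
  show "B w p = 1/2" by (rule pw)
  have ez: "even_real (B (a + b) z)" if "even_real (B a z)" "even_real (B b z)" for a b
    using that by (auto simp: even_real_def) (metis distrib_left of_int_add)
  have en: "even_real (B (c *\<^sub>R a) z)" if "even_real (B a z)" "c \<in> \<int>" for a c
    using that by (auto simp: even_real_def elim!: Ints_cases) (metis mult.left_commute of_int_mult)
  have e2: "even_real (B (2 *\<^sub>R a) z)" if "a \<in> M" for a
    using uni_Ints[OF M that zw(1)] by (auto simp: even_real_def elim!: Ints_cases)
  have M2I: "a + of_int i *\<^sub>R p \<in> M2" if "a \<in> M" "even_real (B a z)" for a i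
    using that M2 by blast
  have M2I0: "a \<in> M2" if "a \<in> M" "even_real (B a z)" for a
    using M2I[OF that, of 0] by simp
  have ev0: "even_real (B 0 z)" by (simp add: even_real_def)
  show pM2: "p \<in> M2" using M2I[OF uni_zero[OF M] ev0, of 1] by simp
  have zM2: "z \<in> M2" using M2I0[OF zw(1)] zw by (simp add: even_real_def)
  have w2: "2 *\<^sub>R w \<in> M2"
    by (rule M2I0[OF uni_scale[OF M zw(2)] e2[OF zw(2)]]) auto
  have p2: "2 *\<^sub>R p \<in> M" "even_real (B (2 *\<^sub>R p) z)"
  proof -
    have "2 *\<^sub>R p = z + 2 *\<^sub>R w" by (simp add: p scaleR_add_right)
    moreover have "z + 2 *\<^sub>R w \<in> M" by (intro uni_add[OF M] uni_scale[OF M] zw) auto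
    ultimately show "2 *\<^sub>R p \<in> M" by simp
    show "even_real (B (2 *\<^sub>R p) z)" using pz by (auto simp: even_real_def intro!: exI[of _ 1])
  qed
  have pI: "2 * B a p \<in> \<int>" if "a \<in> M" for a
    using uni_Ints[OF M that p2(1)] by simp
  have aI: "B a p \<in> \<int>" "B p a \<in> \<int>" if a: "a \<in> M" "even_real (B a z)" for a
  proof -
    obtain l :: int where "B a z = 2 * of_int l" using a by (auto simp: even_real_def)
    then have "B a p = of_int l + B a w" by (simp add: p)
    then show "B a p \<in> \<int>" using uni_Ints[OF M a(1) zw(2)] by simp
    then show "B p a \<in> \<int>" by (simp add: B_sym[of p a])
  qed
  have M2E: "\<exists>a i. a \<in> M \<and> even_real (B a z) \<and> x = a + of_int i *\<^sub>R p" if "x \<in> M2" for x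
    using that M2 by blast
  have M2add: "x + y \<in> M2" if xy: "x \<in> M2" "y \<in> M2" for x y
  proof -
    obtain a i b j where "a \<in> M" "even_real (B a z)" "x = a + of_int i *\<^sub>R p"
      "b \<in> M" "even_real (B b z)" "y = b + of_int j *\<^sub>R p" using M2E[OF xy(1)] M2E[OF xy(2)] by blast
    then have "a + b \<in> M" "even_real (B (a + b) z)" "x + y = (a + b) + of_int (i + j) *\<^sub>R p"
      using ez uni_add[OF M] by (auto simp: algebra_simps)
    then show ?thesis using M2I by metis
  qed
  have M2neg: "- x \<in> M2" if x: "x \<in> M2" for x
  proof -
    obtain a i where a: "a \<in> M" "even_real (B a z)" "x = a + of_int i *\<^sub>R p"
      using M2E[OF x] by blast
    then have "- a \<in> M" "even_real (B (- a) z)" "- x = - a + of_int (- i) *\<^sub>R p"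
      using en[of a "- 1"] uni_minus[OF M] by auto
    then show ?thesis using M2I by metis
  qed
  have M2int: "B x y \<in> \<int>" if xy: "x \<in> M2" "y \<in> M2" for x y
  proof -
    obtain a i b j where ab: "a \<in> M" "even_real (B a z)" "x = a + of_int i *\<^sub>R p"
      "b \<in> M" "even_real (B b z)" "y = b + of_int j *\<^sub>R p" using M2E[OF xy(1)] M2E[OF xy(2)] by blast
    have "B x y = B a b + of_int j * B a p + of_int i * B p b + of_int i * of_int j"
      using pp by (simp add: ab algebra_simps)
    then show ?thesis using uni_Ints[OF M ab(1) ab(4)] aI ab by simp
  qed
  have M22: "2 *\<^sub>R x \<in> M" if x: "x \<in> M2" for x
  proof -
    obtain a i where a: "a \<in> M" "x = a + of_int i *\<^sub>R p" using M2E[OF x] by blast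
    have "2 *\<^sub>R x = 2 *\<^sub>R a + of_int i *\<^sub>R (2 *\<^sub>R p)" by (simp add: a algebra_simps)
    moreover have "2 *\<^sub>R a + of_int i *\<^sub>R (2 *\<^sub>R p) \<in> M"
      by (intro uni_add[OF M] uni_scale[OF M] a p2(1)) auto
    ultimately show ?thesis by simp
  qed
  have MM2: "2 *\<^sub>R x \<in> M2" if "x \<in> M" for x
    by (rule M2I0[OF uni_scale[OF M that] e2[OF that]]) auto
  show "2 *\<^sub>R x \<in> M2" if "x \<in> M2" for x
    using M2add[OF that that] by (simp add: scaleR_2)
  \<comment> \<open>Every \<open>x\<close> in \<open>M\<close> is a vector orthogonal to
    \<open>z\<close> plus a multiple of \<open>w\<close>, so integrality on \<open>M0\<close> and at
    \<open>w\<close> gives integrality on all of \<open>M\<close>.\<close>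
  have M0I: "v \<in> M \<and> even_real (B v z)"
    if v: "2 *\<^sub>R v \<in> M" "\<And>x. x \<in> M \<Longrightarrow> even_real (B x z) \<Longrightarrow> B v x \<in> \<int>" "B v w \<in> \<int>" "even_real (B v z)" for v
  proof -
    have "B v x \<in> \<int>" if x: "x \<in> M" for x
    proof -
      define x0 where "x0 = x - B x z *\<^sub>R w"
      have "x0 \<in> M" unfolding x0_def by (intro uni_diff[OF M] uni_scale[OF M] uni_Ints[OF M] x zw)
      moreover have "even_real (B x0 z)" using zw by (simp add: x0_def even_real_def)
      ultimately have "B v x0 \<in> \<int>" using v(2) by blast
      moreover have "B v x = B v x0 + B x z * B v w" by (simp add: x0_def)
      ultimately show ?thesis using v(3) uni_Ints[OF M x zw(1)] by simp
    qed
    then show ?thesis using uni_half[OF M v(1)] v(4) by blast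
  qed
  show U: "unimodular M2"
    unfolding unimodular_def integral_lattice_def
  proof (intro conjI ballI allI impI)
    show "0 \<in> M2" by (rule M2I0[OF uni_zero[OF M] ev0])
    show "x = 0" if x: "x \<in> M2" and o: "\<forall>y\<in>M2. B x y = 0" for x
    proof -
      have "2 *\<^sub>R x = 0"
      proof (rule uni_nondeg[OF M M22[OF x]])
        show "B (2 *\<^sub>R x) y = 0" if "y \<in> M" for y
          using o MM2[OF that] by (auto dest!: bspec)
      qed
      then show ?thesis by simp
    qed
    fix \<phi> :: "'a \<Rightarrow> real"
    assume \<phi>: "(\<forall>x\<in>M2. \<phi> x \<in> \<int>) \<and> (\<forall>x\<in>M2. \<forall>y\<in>M2. \<phi> (x + y) = \<phi> x + \<phi> y)"
    have \<phi>2: "\<phi> (2 *\<^sub>R x) = 2 * \<phi> x" if "x \<in> M2" for x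
      using \<phi> that by (simp add: scaleR_2)
    \<comment> \<open>Doubling maps \<open>M\<close> into \<open>M2\<close>, so the functional
      composed with doubling is represented in \<open>M\<close>; half of the representative is the
      candidate \<open>y\<close>.\<close>
    have "\<exists>y\<in>M. \<forall>x\<in>M. \<phi> (2 *\<^sub>R x) = B y x"
      by (rule uni_dual[OF M]) (use \<phi> MM2 in \<open>auto simp: scaleR_add_right\<close>)
    then obtain y1 where y1: "y1 \<in> M" "\<And>x. x \<in> M \<Longrightarrow> \<phi> (2 *\<^sub>R x) = B y1 x" by blast
    define y where "y = (1/2) *\<^sub>R y1"
    have y2: "2 *\<^sub>R y \<in> M" using y1 by (simp add: y_def)
    have \<phi>y: "\<phi> x = B y x" if x: "x \<in> M2" for x
    proof -
      have "2 * \<phi> (2 *\<^sub>R x) = 2 * B y1 x"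
        using y1(2)[OF M22[OF x]] \<phi>2[OF MM2[OF M22[OF x]]] \<phi>2[of "2 *\<^sub>R x"] M2add[OF x x]
        by (simp add: scaleR_2)
      then show ?thesis using \<phi>2[OF x] by (simp add: y_def)
    qed
    have yint: "B y x \<in> \<int>" if "x \<in> M2" for x using \<phi> \<phi>y[OF that] that by metis
    \<comment> \<open>Since \<open>B y p\<close> is an integer, \<open>B y z\<close> and twice
      \<open>B y w\<close> have equal parity. If both are even then \<open>y\<close> lies in
      \<open>M0\<close>, if both are odd then \<open>y - p\<close> does.\<close>
    obtain b where b: "B y z = of_int b" using yint[OF zM2] by (auto elim: Ints_cases)
    obtain a where "B y (2 *\<^sub>R w) = of_int a" using yint[OF w2] by (auto elim: Ints_cases)
    then have a: "B y w = of_int a / 2" by simp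
    obtain i where "B y p = of_int i" using yint[OF pM2] by (auto elim: Ints_cases)
    then have "of_int (a + b) = (of_int (2 * i) :: real)" using a b by (simp add: p field_simps)
    then have ab: "a + b = 2 * i" by (simp only: of_int_eq_iff)
    have "y \<in> M2"
    proof (cases "even b")
      case True
      then have "even a" using ab by presburger
      have "y \<in> M \<and> even_real (B y z)"
      proof (rule M0I[OF y2])
        show "B y x \<in> \<int>" if "x \<in> M" "even_real (B x z)" for x using yint[OF M2I0[OF that]] .
        show "B y w \<in> \<int>" using a \<open>even a\<close> by (auto elim!: evenE)
        show "even_real (B y z)" using b True by (simp add: even_real_iff)
      qed
      then show ?thesis using M2I0 by blast
    next
      case False
      then have "odd a" using ab by presburger
      have "y - p \<in> M \<and> even_real (B (y - p) z)"
      proof (rule M0I)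
        show "2 *\<^sub>R (y - p) \<in> M" using uni_diff[OF M y2 p2(1)] by (simp add: scaleR_diff_right)
        show "B (y - p) x \<in> \<int>" if "x \<in> M" "even_real (B x z)" for x
          using yint[OF M2I0[OF that]] aI(2)[OF that] by simp
        obtain a' where "a = 2 * a' + 1" using \<open>odd a\<close> by (rule oddE)
        then have "B (y - p) w = of_int a'" using a pw(1) by (simp add: field_simps)
        then show "B (y - p) w \<in> \<int>" by simp
        have "B (y - p) z = of_int (b - 1)" using b pz by simp
        then show "even_real (B (y - p) z)" using False by (simp only: even_real_iff) simp
      qed
      then show ?thesis using M2I[of "y - p" 1] by simp
    qed
    then show "\<exists>y\<in>M2. \<forall>x\<in>M2. \<phi> x = B y x" using \<phi>y by blast
  qed (use M2add M2neg M2int in auto)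
  have F: "frame M2 k"
  proof -
    obtain e and d :: int where d: "d \<noteq> 0" and e: "orthonormal k e"
      and de: "\<And>i. i \<le> k \<Longrightarrow> of_int d *\<^sub>R e i \<in> M"
      and nd: "\<And>x. x \<in> M \<Longrightarrow> (\<And>i. i \<le> k \<Longrightarrow> B x (e i) = 0) \<Longrightarrow> x = 0"
      using fr unfolding frame_def by blast
    show ?thesis
      unfolding frame_def
    proof (intro exI[of _ e] exI[of _ "2 * d"] conjI allI impI ballI)
      show "of_int (2 * d) *\<^sub>R e i \<in> M2" if "i \<le> k" for i
        using MM2[OF de[OF that]] by simp
      fix x assume x: "x \<in> M2" and o: "\<forall>i\<le>k. B x (e i) = 0"
      have "2 *\<^sub>R x = 0" by (rule nd[OF M22[OF x]]) (use o in simp)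
      then show "x = 0" by simp
    qed (use d e in auto)
  qed
  have "odd_real (B p p)" by (simp add: pp odd_real_def)
  then show "\<exists>e. onb M2 k e" by (rule odd_unimodular_onb[OF U F pM2])
  show "x \<in> M2 \<and> even_real (B x x) \<longleftrightarrow> x \<in> M \<and> even_real (B x z)" for x
  proof
    assume "x \<in> M \<and> even_real (B x z)"
    then show "x \<in> M2 \<and> even_real (B x x)" using M2I0 ev by blast
  next
    \<comment> \<open>The norm of \<open>a + i p\<close> has the parity of \<open>i\<close>, and
      even multiples of \<open>p\<close> lie in \<open>M0\<close>.\<close>
    assume x: "x \<in> M2 \<and> even_real (B x x)"
    then obtain a i where a: "a \<in> M" "even_real (B a z)" "x = a + of_int i *\<^sub>R p" using M2E by blast
    obtain l :: int where l: "B a a = 2 * of_int l" using ev[OF a(1)] by (auto simp: even_real_def)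
    obtain b where b: "B a p = of_int b" using aI[OF a(1,2)] by (auto elim: Ints_cases)
    have "B x x = of_int (2 * l + 2 * i * b + i * i)"
      using l b pp by (simp add: a B_sym[of p a] algebra_simps)
    then have "even (2 * l + 2 * i * b + i * i)" using x by (simp only: even_real_iff)
    then have "even i" by simp
    then obtain j where j: "i = 2 * j" by (auto elim: evenE)
    have xj: "x = a + of_int j *\<^sub>R (2 *\<^sub>R p)" by (simp add: a j)
    show "x \<in> M \<and> even_real (B x z)"
      unfolding xj by (intro conjI uni_add[OF M] uni_scale[OF M] a p2 ez en) auto
  qed
qed

text \<open>In an orthonormal basis of the odd neighbour, the vectors of \<open>M\<close> with even
  product with \<open>z\<close> are the integer points with even coordinate sum. The other coset is
  that of \<open>w'\<close>, whose coordinates all lie in 1/2 plus the integers. So \<open>M\<close>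
  is D^+ once the parity for \<open>w'\<close> is adjusted.\<close>

lemma even_unimodular_coords:
  assumes M: "unimodular M" and ev: "\<And>x. x \<in> M \<Longrightarrow> even_real (B x x)" and fr: "frame M k"
    and z: "z \<in> M" "B z z = 0" and w: "w \<in> M" "B z w = 1"
  shows "\<exists>e. orthonormal k e \<and> M = lin k e ` dplus_coords k"
proof -
  obtain h :: int where h: "B w w = 2 * of_int h" using ev[OF w(1)] by (auto simp: even_real_def)
  \<comment> \<open>Evenness of \<open>M\<close> allows \<open>w\<close> to be made isotropic by
    subtracting half its norm times \<open>z\<close>.\<close>
  define w' where "w' = w - of_int h *\<^sub>R z"
  have wM: "w' \<in> M" unfolding w'_def by (intro uni_diff[OF M] uni_scale[OF M] z w) auto
  have w': "B w' w' = 0" "B z w' = 1" "B w' z = 1"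
    using z w h by (simp_all add: w'_def B_sym[of w z])
  define p where "p = (1/2) *\<^sub>R z + w'"
  define M2 where "M2 = {x. \<exists>a\<in>M. \<exists>i::int. even_real (B a z) \<and> x = a + of_int i *\<^sub>R p}"
  note nb = odd_neighbour[OF M ev fr z(1) wM z(2) w' p_def M2_def]
  have U: "unimodular M2" and M0: "\<And>x. x \<in> M2 \<and> even_real (B x x) \<longleftrightarrow> x \<in> M \<and> even_real (B x z)"
    and p: "p \<in> M2" "B w' p = 1/2"
    using nb by blast+
  obtain e0 where e0: "onb M2 k e0" using nb(2) by blast
  have w2: "2 *\<^sub>R w' \<in> M2"
  proof -
    have "2 *\<^sub>R w' \<in> M" by (intro uni_scale[OF M] wM) auto
    moreover have "even_real (B (2 *\<^sub>R w') z)" using w' by (auto simp: even_real_def intro!: exI[of _ 1])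
    ultimately show ?thesis using M0 by blast
  qed
  have half: "\<exists>t::nat \<Rightarrow> int. w' = lin k e (\<lambda>i. of_int (t i) + 1/2)" if e: "onb M2 k e" for e
  proof -
    have eM: "\<And>i. i \<le> k \<Longrightarrow> e i \<in> M2" and eo: "orthonormal k e"
      and en: "\<And>x. x \<in> M2 \<Longrightarrow> (\<And>i. i \<le> k \<Longrightarrow> B x (e i) = 0) \<Longrightarrow> x = 0"
      using e unfolding onb_def by auto
    have ee: "B (e i) (e j) = (if i = j then eta i else 0)" if "i \<le> k" "j \<le> k" for i j
      using eo that by (simp add: orthonormal_def)
    have sum: "B w' (e i) + B w' (e j) \<in> \<int>" if ij: "i \<le> k" "j \<le> k" for i j
    proof -
      have "e i + e j \<in> M2" by (intro uni_add[OF U] eM ij)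
      moreover have "even_real (B (e i + e j) (e i + e j))"
      proof -
        have "B (e i + e j) (e i + e j) \<in> (\<lambda>k. 2 * of_int k) ` {- 2, -1, 0, 1, 2}"
          using ee ij by (auto simp: eta_def image_def)
        then show ?thesis unfolding even_real_def by blast
      qed
      ultimately have "e i + e j \<in> M" using M0 by blast
      then show ?thesis using uni_Ints[OF M wM] by fastforce
    qed
    \<comment> \<open>\<open>w'\<close> is not in \<open>M2\<close>, but \<open>2 w'\<close> is, and
      its expansion can be halved.\<close>
    have expand: "w' = lin k e (\<lambda>i. eta i * B w' (e i))"
    proof -
      have "2 *\<^sub>R w' = lin k e (\<lambda>i. eta i * B (2 *\<^sub>R w') (e i))" by (rule onb_expand[OF U e w2])
      also have "\<dots> = 2 *\<^sub>R lin k e (\<lambda>i. eta i * B w' (e i))"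
        unfolding lin_def scaleR_sum_right by (intro sum.cong) (auto simp: algebra_simps)
      finally show ?thesis by simp
    qed
    \<comment> \<open>By \<open>sum\<close>, one integral coordinate would make all of them integral
      and put \<open>w'\<close> into \<open>M2\<close>, against \<open>B w' p = 1/2\<close>.\<close>
    have nint: "B w' (e i) \<notin> \<int>" if i: "i \<le> k" for i
    proof
      assume ii: "B w' (e i) \<in> \<int>"
      have "B w' (e j) \<in> \<int>" if "j \<le> k" for j
        using Ints_diff[OF sum[OF i that] ii] by simp
      then have "lin k e (\<lambda>i. eta i * B w' (e i)) \<in> M2"
        by (intro lin_mem[OF U eM]) (auto simp: eta_def)
      then have "w' \<in> M2" using expand by simp
      then have "(1/2::real) \<in> \<int>" using uni_Ints[OF U _ p(1)] p(2) by metis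
      then obtain c :: int where "1/2 = (of_int c :: real)" by (auto elim: Ints_cases)
      then have "of_int (2 * c) = (1::real)" by simp
      then have "2 * c = 1" by (simp only: of_int_eq_1_iff)
      then show False by presburger
    qed
    have "\<exists>t::int. i \<le> k \<longrightarrow> eta i * B w' (e i) = of_int t + 1/2" for i
    proof (cases "i \<le> k")
      case True
      obtain c :: int where c: "B w' (e i) + B w' (e i) = of_int c"
        using sum[OF True True] by (auto elim: Ints_cases)
      have "odd c"
      proof
        assume "even c"
        then obtain b where "c = 2 * b" by (auto elim: evenE)
        then have "B w' (e i) = of_int b" using c by simp
        then show False using nint[OF True] by simp
      qed
      then obtain b where "c = 2 * b + 1" by (auto elim: oddE)
      then have "B w' (e i) = of_int b + 1/2" using c by simp
      then have "eta i * B w' (e i) = of_int b + 1/2 \<or> eta i * B w' (e i) = of_int (- b - 1) + 1/2"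
        by (auto simp: eta_def)
      then show ?thesis by blast
    qed auto
    then obtain t :: "nat \<Rightarrow> int" where "\<And>i. i \<le> k \<Longrightarrow> eta i * B w' (e i) = of_int (t i) + 1/2" by metis
    then have "lin k e (\<lambda>i. eta i * B w' (e i)) = lin k e (\<lambda>i. of_int (t i) + 1/2)" by (rule lin_cong)
    then show ?thesis using expand by metis
  qed
  text \<open>Reversing \<open>e 0\<close> exchanges the two even unimodular neighbours of \<open>M2\<close>.\<close>
  obtain e and t :: "nat \<Rightarrow> int" where e: "onb M2 k e" and wt: "w' = lin k e (\<lambda>i. of_int (t i) + 1/2)"
    and te: "even (\<Sum>i\<le>k. t i)"
  proof -
    obtain t :: "nat \<Rightarrow> int" where t: "w' = lin k e0 (\<lambda>i. of_int (t i) + 1/2)" using half[OF e0] by blast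
    show thesis
    proof (cases "even (\<Sum>i\<le>k. t i)")
      case True
      then show ?thesis using that e0 t by blast
    next
      case False
      define e where "e = e0(0 := - e0 0)"
      \<comment> \<open>Negating \<open>t 0 + 1/2\<close> gives \<open>(- t 0 - 1) + 1/2\<close>,
        which changes the parity of the sum.\<close>
      define t' where "t' = t(0 := - t 0 - 1)"
      have "onb M2 k e"
        unfolding onb_def
      proof (intro conjI allI impI ballI)
        show "orthonormal k e" using e0 unfolding onb_def orthonormal_def by (auto simp: e_def)
        show "e i \<in> M2" if "i \<le> k" for i
          using e0 that uni_minus[OF U] unfolding onb_def by (auto simp: e_def)
        show "x = 0" if "x \<in> M2" and o: "\<forall>i\<le>k. B x (e i) = 0" for x
        proof -
          have "B x (e0 i) = 0" if "i \<le> k" for i using o that by (cases "i = 0") (auto simp: e_def dest: spec[of _ i])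
          then show ?thesis using e0 \<open>x \<in> M2\<close> unfolding onb_def by blast
        qed
      qed
      moreover have "w' = lin k e (\<lambda>i. of_int (t' i) + 1/2)"
        unfolding t lin_def
        by (intro sum.cong) (auto simp: e_def t'_def algebra_simps simp flip: scaleR_add_left)
      moreover have "even (\<Sum>i\<le>k. t' i)"
      proof -
        have "(\<Sum>i\<le>k. t' i) = t' 0 + (\<Sum>i\<in>{..k} - {0}. t' i)" by (rule sum.remove) auto
        also have "(\<Sum>i\<in>{..k} - {0}. t' i) = (\<Sum>i\<in>{..k} - {0}. t i)" by (intro sum.cong) (auto simp: t'_def)
        finally have "(\<Sum>i\<le>k. t' i) = - t 0 - 1 + (\<Sum>i\<in>{..k} - {0}. t i)" by (simp add: t'_def)
        moreover have "(\<Sum>i\<le>k. t i) = t 0 + (\<Sum>i\<in>{..k} - {0}. t i)" by (rule sum.remove) auto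
        ultimately show ?thesis using False by presburger
      qed
      ultimately show ?thesis using that by blast
    qed
  qed
  have eo: "orthonormal k e" and eM: "\<And>i. i \<le> k \<Longrightarrow> e i \<in> M2" using e by (auto simp: onb_def)
  have M0lin: "lin k e (\<lambda>i. of_int (s i)) \<in> M \<and> even_real (B (lin k e (\<lambda>i. of_int (s i))) z)"
    if "even (\<Sum>i\<le>k. s i)" for s :: "nat \<Rightarrow> int"
  proof -
    have "lin k e (\<lambda>i. of_int (s i)) \<in> M2" by (rule lin_mem[OF U eM]) auto
    then show ?thesis using M0 even_real_lin[OF eo] that by blast
  qed
  have M0ex: "\<exists>s::nat \<Rightarrow> int. even (\<Sum>i\<le>k. s i) \<and> x = lin k e (\<lambda>i. of_int (s i))"
    if x: "x \<in> M" "even_real (B x z)" for x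
  proof -
    have x2: "x \<in> M2" "even_real (B x x)" using M0 x by blast+
    obtain s :: "nat \<Rightarrow> int" where s: "x = lin k e (\<lambda>i. of_int (s i))" by (rule onb_int_expand[OF U e x2(1)])
    then have "even (\<Sum>i\<le>k. s i)" using x2(2) even_real_lin[OF eo] by simp
    then show ?thesis using s by blast
  qed
  have "M = lin k e ` dplus_coords k"
  proof (intro equalityI subsetI)
    fix x assume x: "x \<in> M"
    obtain a where a: "B x z = of_int a" by (rule uni_int[OF M x z(1)])
    show "x \<in> lin k e ` dplus_coords k"
    proof (cases "even a")
      case True
      then obtain s :: "nat \<Rightarrow> int" where "even (\<Sum>i\<le>k. s i)" "x = lin k e (\<lambda>i. of_int (s i))"
        using M0ex[OF x] a by (auto simp: even_real_iff)
      then show ?thesis unfolding dplus_coords_def by blast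
    next
      case False
      have "x - w' \<in> M" by (intro uni_diff[OF M] x wM)
      moreover have "B (x - w') z = of_int (a - 1)" using a w' by simp
      then have "even_real (B (x - w') z)" using False by (simp only: even_real_iff) simp
      ultimately obtain s :: "nat \<Rightarrow> int" where s: "even (\<Sum>i\<le>k. s i)" "x - w' = lin k e (\<lambda>i. of_int (s i))"
        using M0ex by blast
      have "x = lin k e (\<lambda>i. of_int (s i)) + w'" using s(2) by (simp add: algebra_simps)
      then have "x = lin k e (\<lambda>i. of_int (s i + t i) + 1/2)"
        by (simp add: wt lin_add add.assoc)
      moreover have "even (\<Sum>i\<le>k. s i + t i)" using s(1) te by (simp add: sum.distrib)
      then have "(\<lambda>i. of_int (s i + t i) + 1/2) \<in> dplus_coords k"
        unfolding dplus_coords_def by (intro CollectI exI[of _ "\<lambda>i. s i + t i"]) auto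
      ultimately show ?thesis by blast
    qed
  next
    fix x assume "x \<in> lin k e ` dplus_coords k"
    then obtain r and s :: "nat \<Rightarrow> int" where x: "x = lin k e r" and s: "even (\<Sum>i\<le>k. s i)"
      and r: "(\<forall>i\<le>k. r i = of_int (s i)) \<or> (\<forall>i\<le>k. r i = of_int (s i) + 1/2)"
      unfolding dplus_coords_def by blast
    from r show "x \<in> M"
    proof
      assume "\<forall>i\<le>k. r i = of_int (s i)"
      then have "x = lin k e (\<lambda>i. of_int (s i))" unfolding x by (intro lin_cong) auto
      then show ?thesis using M0lin[OF s] by simp
    next
      assume r: "\<forall>i\<le>k. r i = of_int (s i) + 1/2"
      have "x = lin k e (\<lambda>i. of_int (s i - t i)) + w'"
        unfolding x wt lin_add by (intro lin_cong) (simp add: r)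
      moreover have "even (\<Sum>i\<le>k. s i - t i)" using s te by (simp add: sum_subtractf)
      then have "lin k e (\<lambda>i. of_int (s i - t i)) \<in> M" using M0lin by blast
      ultimately show ?thesis using uni_add[OF M _ wM] by simp
    qed
  qed
  then show ?thesis using eo by blast
qed

section \<open>Isometry of any two admissible pairs\<close>

lemma admissible_one_coords:
  assumes ad: "admissible (Suc k) 1 L u" and k: "1 \<le> k"
  shows "\<exists>e. orthonormal k e \<and> perp L u = lin k e ` dplus_coords k"
proof -
  obtain e x1 where L: "unimodular L" and onb: "onb L (Suc k) e" and u: "characteristic L u"
    and uu: "B u u = - 1" and x1: "x1 \<in> L" "B u x1 = 1"
    using ad unfolding admissible_def by auto
  have uL: "u \<in> L" and char: "\<And>x. x \<in> L \<Longrightarrow> even_real (B u x - B x x)"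
    using u by (auto simp: characteristic_def)
  have "\<exists>z\<in>L. \<exists>w\<in>L. B z u = 0 \<and> B w u = 0 \<and> B z z = 0 \<and> B z w = 1"
    by (rule isotropic_pair[OF L onb, of 1 u]) (use k u uu x1 in auto)
  then obtain z w where zw: "z \<in> perp L u" "w \<in> perp L u" "B z z = 0" "B z w = 1"
    by (auto simp: perp_def)
  have M: "unimodular (perp L u)" using unimodular_perp[OF L uL uu] by simp
  \<comment> \<open>For \<open>x\<close> orthogonal to the characteristic \<open>u\<close>, the norm
    of \<open>x\<close> is congruent to \<open>B u x = 0\<close> modulo 2.\<close>
  have ev: "even_real (B x x)" if "x \<in> perp L u" for x
  proof -
    have "even_real (- B x x)" using char[of x] that B_sym[of u x] by (simp add: perp_def)
    then obtain a :: int where "- B x x = 2 * of_int a" by (auto simp: even_real_def)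
    then have "B x x = 2 * of_int (- a)" by simp
    then show ?thesis unfolding even_real_def by blast
  qed
  show ?thesis
    by (rule even_unimodular_coords[OF M ev frame_perp[OF L onb_imp_frame[OF onb] uL uu] zw(1,3,2,4)])
qed

text \<open>For \<open>m = 1\<close> both complements have the same coordinate set, that of D^+. For
  larger \<open>m\<close> both pairs are reduced by vectors of norm -1, and the isometry of the
  complements is extended.\<close>

theorem admissible_pair_iso:
  assumes "1 \<le> m" "m < n" "admissible n m L1 u1" "admissible n m L2 u2"
  shows "pair_iso L1 u1 L2 u2"
  using assms
proof (induction m arbitrary: n L1 u1 L2 u2 rule: nat_induct_at_least)
  case base
  then obtain k where k: "n = Suc k" "1 \<le> k" by (cases n) auto
  obtain e1 where e1: "orthonormal k e1" "perp L1 u1 = lin k e1 ` dplus_coords k"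
    using admissible_one_coords base k by blast
  obtain e2 where e2: "orthonormal k e2" "perp L2 u2 = lin k e2 ` dplus_coords k"
    using admissible_one_coords base k by blast
  obtain \<phi> where \<phi>: "\<phi> ` perp L1 u1 = perp L2 u2" "\<And>x y. \<phi> (x + y) = \<phi> x + \<phi> y"
    "\<And>x y. x \<in> perp L1 u1 \<Longrightarrow> y \<in> perp L1 u1 \<Longrightarrow> B (\<phi> x) (\<phi> y) = B x y"
    using lin_isometry[OF e1(1) e2(1), of "dplus_coords k"] e1(2) e2(2) by metis
  have L: "unimodular L1" "unimodular L2" and u: "u1 \<in> L1" "u2 \<in> L2" "B u1 u1 = - 1" "B u2 u2 = - 1"
    using base by (auto simp: admissible_def characteristic_def)
  have "0 \<in> perp L1 u1" using uni_zero[OF L(1)] by (simp add: perp_def)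
  then have "pair_iso L1 (0 + 1 *\<^sub>R u1) L2 (\<phi> 0 + 1 *\<^sub>R u2)"
    by (intro perp_isometry_extend[OF L u(1,3,2,4)] \<phi>) auto
  moreover have "\<phi> 0 = 0" using \<phi>(2)[of 0 0] by simp
  ultimately show ?case by simp
next
  case (Suc m)
  obtain k where k: "n = Suc k" "m < k" using Suc.prems by (cases n) auto
  obtain r1 where r1: "r1 \<in> L1" "B r1 r1 = - 1" "B u1 r1 = 1" "admissible k m (perp L1 r1) (u1 + r1)"
    using admissible_reduce Suc k by blast
  obtain r2 where r2: "r2 \<in> L2" "B r2 r2 = - 1" "B u2 r2 = 1" "admissible k m (perp L2 r2) (u2 + r2)"
    using admissible_reduce Suc k by blast
  have "pair_iso (perp L1 r1) (u1 + r1) (perp L2 r2) (u2 + r2)"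
    using Suc.IH[OF k(2) r1(4) r2(4)] .
  then obtain \<phi> where \<phi>: "\<phi> ` perp L1 r1 = perp L2 r2"
    "\<And>x y. x \<in> perp L1 r1 \<Longrightarrow> y \<in> perp L1 r1 \<Longrightarrow> \<phi> (x + y) = \<phi> x + \<phi> y"
    "\<And>x y. x \<in> perp L1 r1 \<Longrightarrow> y \<in> perp L1 r1 \<Longrightarrow> B (\<phi> x) (\<phi> y) = B x y" "\<phi> (u1 + r1) = u2 + r2"
    unfolding pair_iso_def by metis
  have L: "unimodular L1" "unimodular L2" using Suc.prems by (auto simp: admissible_def)
  have "u1 + r1 \<in> perp L1 r1" using r1(4) by (simp add: admissible_def characteristic_def)
  then have "pair_iso L1 ((u1 + r1) + (- 1) *\<^sub>R r1) L2 (\<phi> (u1 + r1) + (- 1) *\<^sub>R r2)"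
    by (intro perp_isometry_extend[OF L r1(1,2) r2(1,2)] \<phi>) auto
  then show ?case using \<phi>(4) by simp
qed

section \<open>The integer span of an orthonormal family\<close>

lemma additive_int_scale:
  fixes \<phi> :: "'a \<Rightarrow> 'b::real_vector"
  assumes L: "\<And>k. of_int k *\<^sub>R x \<in> L"
    and add: "\<And>a b. a \<in> L \<Longrightarrow> b \<in> L \<Longrightarrow> \<phi> (a + b) = \<phi> a + \<phi> b"
  shows "\<phi> (of_int k *\<^sub>R x) = of_int k *\<^sub>R \<phi> x"
proof -
  have x: "x \<in> L" "0 \<in> L" using L[of 1] L[of 0] by simp_all
  show ?thesis
  proof (induction k rule: int_induct[where k = 0])
    case base
    then show ?case using add[OF x(2) x(2)] by simp
  next
    case (step1 i)
    have "\<phi> (of_int (i + 1) *\<^sub>R x) = \<phi> (of_int i *\<^sub>R x) + \<phi> x"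
      using add[OF L x(1)] by (simp add: scaleR_add_left)
    then show ?case using step1 by (simp add: scaleR_add_left)
  next
    case (step2 i)
    have "\<phi> (of_int i *\<^sub>R x) = \<phi> (of_int (i - 1) *\<^sub>R x) + \<phi> x"
      using add[OF L[of "i - 1"] x(1)] by (simp add: scaleR_diff_left)
    then show ?case using step2 by (simp add: scaleR_diff_left)
  qed
qed

text \<open>A functional is determined by its values on the \<open>e i\<close>; multiplied by the
  signs \<open>eta i\<close>, these values are the coordinates of its representative.\<close>

lemma int_span_unimodular:
  assumes eo: "orthonormal n e" and Ldef: "L = lin n e ` {s. \<forall>i. s i \<in> \<int>}"
  shows "unimodular L" and "onb L n e"
proof -
  have linI: "lin n e s \<in> L" if "\<And>i. i \<le> n \<Longrightarrow> s i \<in> \<int>" for s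
  proof -
    have "lin n e s = lin n e (\<lambda>i. if i \<le> n then s i else 0)" by (rule lin_cong) simp
    then show ?thesis unfolding Ldef using that by auto
  qed
  have linE: "\<exists>s. (\<forall>i. s i \<in> \<int>) \<and> x = lin n e s" if "x \<in> L" for x using that Ldef by blast
  have scale: "c *\<^sub>R lin n e s = lin n e (\<lambda>i. c * s i)" for c s
    by (simp add: lin_def scaleR_sum_right)
  have eL: "e j \<in> L" if "j \<le> n" for j
  proof -
    have "e j = lin n e (\<lambda>i. if i = j then 1 else 0)"
      using that by (simp add: lin_def if_distrib[of "\<lambda>c. c *\<^sub>R _"] cong: if_cong)
    then show ?thesis using linI[of "\<lambda>i. if i = j then 1 else 0"] by simp
  qed
  have nd: "x = 0" if "x \<in> L" "\<And>i. i \<le> n \<Longrightarrow> B x (e i) = 0" for x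
  proof -
    obtain s where s: "x = lin n e s" using linE[OF \<open>x \<in> L\<close>] by blast
    have "s i = 0" if "i \<le> n" for i
      using \<open>\<And>i. i \<le> n \<Longrightarrow> B x (e i) = 0\<close>[OF that] B_lin_basis(1)[OF eo that, of s]
      by (simp add: s eta_def split: if_splits)
    then show ?thesis by (simp add: s lin_def)
  qed
  then show "onb L n e" unfolding onb_def using eo eL by blast
  have add: "x + y \<in> L" if "x \<in> L" "y \<in> L" for x y
    using linE[OF that(1)] linE[OF that(2)] by (auto simp: lin_add intro!: linI)
  have zero: "0 \<in> L" using linI[of "\<lambda>_. 0"] by (simp add: lin_def)
  have sc: "of_int k *\<^sub>R x \<in> L" if "x \<in> L" for k x
    using linE[OF that] by (auto simp: scale intro!: linI)
  show "unimodular L"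
    unfolding unimodular_def integral_lattice_def
  proof (intro conjI ballI allI impI)
    show "- x \<in> L" if "x \<in> L" for x using sc[OF that, of "- 1"] by simp
    show "B x y \<in> \<int>" if xy: "x \<in> L" "y \<in> L" for x y
    proof -
      obtain s t where "\<forall>i. s i \<in> \<int>" "\<forall>i. t i \<in> \<int>" "x = lin n e s" "y = lin n e t"
        using linE[OF xy(1)] linE[OF xy(2)] by blast
      then show ?thesis by (auto simp: B_lin_lin[OF eo] eta_def)
    qed
    show "x = 0" if "x \<in> L" "\<forall>y\<in>L. B x y = 0" for x using nd that eL by blast
    fix \<phi> :: "'a \<Rightarrow> real"
    assume \<phi>: "(\<forall>x\<in>L. \<phi> x \<in> \<int>) \<and> (\<forall>x\<in>L. \<forall>y\<in>L. \<phi> (x + y) = \<phi> x + \<phi> y)"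
    have \<phi>0: "\<phi> 0 = 0" using \<phi> zero by force
    have sumL: "(\<Sum>i\<in>A. s i *\<^sub>R e i) \<in> L \<and> \<phi> (\<Sum>i\<in>A. s i *\<^sub>R e i) = (\<Sum>i\<in>A. s i * \<phi> (e i))"
      if "finite A" "A \<subseteq> {..n}" "\<forall>i. s i \<in> \<int>" for A s
      using that
    proof (induction A)
      case (insert i A)
      obtain k where k: "s i = of_int k" using insert.prems by (meson Ints_cases)
      have iL: "s i *\<^sub>R e i \<in> L" unfolding k using sc eL insert.prems by auto
      have "\<phi> (s i *\<^sub>R e i) = s i * \<phi> (e i)"
        unfolding k using additive_int_scale[of "e i" L \<phi> k] sc eL insert.prems \<phi> by auto
      then show ?case using insert iL \<phi> add by simp
    qed (use zero \<phi>0 in auto)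
    show "\<exists>y\<in>L. \<forall>x\<in>L. \<phi> x = B y x"
    proof (intro bexI[of _ "lin n e (\<lambda>i. eta i * \<phi> (e i))"] ballI)
      show "lin n e (\<lambda>i. eta i * \<phi> (e i)) \<in> L"
        using \<phi> eL by (intro linI) (auto simp: eta_def)
      fix x assume "x \<in> L"
      then obtain s where s: "\<forall>i. s i \<in> \<int>" "x = lin n e s" using linE by blast
      have "\<phi> x = (\<Sum>i\<le>n. s i * \<phi> (e i))" using sumL[of "{..n}" s] s by (simp add: lin_def)
      also have "\<dots> = B (lin n e (\<lambda>i. eta i * \<phi> (e i))) x"
        unfolding s(2) B_lin_lin[OF eo] by (intro sum.cong) (auto simp: algebra_simps)
      finally show "\<phi> x = B (lin n e (\<lambda>i. eta i * \<phi> (e i))) x" .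
    qed
  qed (use add zero in auto)
qed

end

section \<open>The standard lattice\<close>

instantiation "fun" :: (type, real_vector) real_vector
begin

definition "c *\<^sub>R f = (\<lambda>x. c *\<^sub>R f x)"

instance
  by standard (simp_all add: scaleR_fun_def fun_eq_iff algebra_simps)

end

lemma scaleR_fun_apply [simp]: "(c *\<^sub>R f) x = c *\<^sub>R f x"
  by (simp add: scaleR_fun_def)

definition lorentz :: "nat \<Rightarrow> (nat \<Rightarrow> real) \<Rightarrow> (nat \<Rightarrow> real) \<Rightarrow> real" where
  "lorentz n x y = x 0 * y 0 - (\<Sum>i = 1..n. x i * y i)"

interpretation lorentz: form_space "lorentz n" for n
  by standard
    (simp_all add: lorentz_def algebra_simps sum.distrib sum_distrib_left)

text \<open>Padding by 0 makes \<open>real_vec u\<close> equal to its expansion in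
  \<open>unit_fun\<close>, which vanishes beyond \<open>n\<close>.\<close>

definition real_vec :: "int vec \<Rightarrow> nat \<Rightarrow> real" where
  "real_vec u = (\<lambda>i. if i < dim_vec u then of_int (u $ i) else 0)"

definition unit_fun :: "nat \<Rightarrow> nat \<Rightarrow> real" where
  "unit_fun i = (\<lambda>j. if i = j then 1 else 0)"

lemma real_vec_add: "u \<in> I_lattice n \<Longrightarrow> v \<in> I_lattice n \<Longrightarrow> real_vec (u + v) = real_vec u + real_vec v"
  by (auto simp: real_vec_def I_lattice_def fun_eq_iff)

lemma real_vec_smult: "real_vec (k \<cdot>\<^sub>v u) = of_int k *\<^sub>R real_vec u"
  by (auto simp: real_vec_def fun_eq_iff)

lemma lorentz_real_vec:
  assumes "u \<in> I_lattice n" "v \<in> I_lattice n"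
  shows "lorentz n (real_vec u) (real_vec v) = of_int (I_form n u v)"
proof -
  have "(\<Sum>i = 1..n. real_vec u i * real_vec v i) = (\<Sum>i = 1..n. of_int (u $ i * v $ i))"
    by (intro sum.cong) (use assms in \<open>auto simp: real_vec_def I_lattice_def\<close>)
  then show ?thesis using assms by (simp add: lorentz_def I_form_def real_vec_def I_lattice_def)
qed

lemma real_vec_inj: "inj_on real_vec (I_lattice n)"
proof (rule inj_onI)
  fix u v assume uv: "u \<in> I_lattice n" "v \<in> I_lattice n" and eq: "real_vec u = real_vec v"
  have "u $ i = v $ i" if "i < Suc n" for i
    using fun_cong[OF eq, of i] uv that by (auto simp: real_vec_def I_lattice_def)
  then show "u = v" using uv by (intro eq_vecI) (auto simp: I_lattice_def)
qed

lemma unit_fun_orthonormal: "lorentz.orthonormal n n unit_fun"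
proof -
  have "lorentz n (unit_fun i) (unit_fun j) = (if i = j then eta i else 0)" if "i \<le> n" "j \<le> n" for i j
  proof -
    have "(\<Sum>l = 1..n. unit_fun i l * unit_fun j l) = (\<Sum>l = 1..n. if l = i then unit_fun j i else 0)"
      by (intro sum.cong) (auto simp: unit_fun_def)
    also have "\<dots> = (if 1 \<le> i then unit_fun j i else 0)" using that by simp
    finally show ?thesis by (auto simp: lorentz_def eta_def) (auto simp: unit_fun_def)
  qed
  then show ?thesis by (simp add: lorentz.orthonormal_def)
qed

lemma lin_unit_fun: "lorentz.lin n unit_fun s = (\<lambda>i. if i \<le> n then s i else 0)"
proof
  fix j
  have "lorentz.lin n unit_fun s j = (\<Sum>i\<le>n. s i * unit_fun i j)"
    unfolding lorentz.lin_def by (induction n) auto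
  also have "\<dots> = (\<Sum>i\<le>n. if i = j then s j else 0)" by (intro sum.cong) (auto simp: unit_fun_def)
  finally show "lorentz.lin n unit_fun s j = (if j \<le> n then s j else 0)" by simp
qed

lemma real_vec_image: "real_vec ` I_lattice n = lorentz.lin n unit_fun ` {s. \<forall>i. s i \<in> \<int>}"
proof (intro equalityI subsetI)
  fix x assume "x \<in> real_vec ` I_lattice n"
  then obtain u where u: "u \<in> I_lattice n" "x = real_vec u" by blast
  have "x = lorentz.lin n unit_fun (real_vec u)"
    using u by (auto simp: lin_unit_fun real_vec_def I_lattice_def)
  moreover have "real_vec u i \<in> \<int>" for i by (simp add: real_vec_def)
  ultimately show "x \<in> lorentz.lin n unit_fun ` {s. \<forall>i. s i \<in> \<int>}" by blast
next
  fix x :: "nat \<Rightarrow> real" assume "x \<in> lorentz.lin n unit_fun ` {s. \<forall>i. s i \<in> \<int>}"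
  then obtain s :: "nat \<Rightarrow> real" where s: "\<And>i. s i \<in> \<int>" "x = lorentz.lin n unit_fun s" by blast
  have "\<forall>i. \<exists>t::int. s i = of_int t" using s(1) by (metis Ints_cases)
  then obtain t :: "nat \<Rightarrow> int" where t: "\<And>i. s i = of_int (t i)" by metis
  have "x = real_vec (vec (Suc n) t)" by (auto simp: s(2) t lin_unit_fun real_vec_def)
  then show "x \<in> real_vec ` I_lattice n" by (auto simp: I_lattice_def)
qed

lemmas I_lattice_unimodular = lorentz.int_span_unimodular[OF unit_fun_orthonormal real_vec_image]

section \<open>Transfer between integer vectors and the lattice of real functions\<close>

lemma characteristic_vec_iff:
  assumes "u \<in> I_lattice n"
  shows "characteristic_vec n u \<longleftrightarrow> lorentz.characteristic n (real_vec ` I_lattice n) (real_vec u)"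
proof -
  have "even_real (lorentz n (real_vec u) (real_vec x) - lorentz n (real_vec x) (real_vec x)) \<longleftrightarrow>
      [I_form n u x = I_form n x x] (mod 2)" if "x \<in> I_lattice n" for x
  proof -
    have "lorentz n (real_vec u) (real_vec x) - lorentz n (real_vec x) (real_vec x) =
        of_int (I_form n u x - I_form n x x)"
      using assms that by (simp add: lorentz_real_vec)
    then show ?thesis by (simp only: even_real_iff cong_iff_dvd_diff)
  qed
  then show ?thesis
    using assms by (auto simp: characteristic_vec_def lorentz.characteristic_def)
qed

text \<open>By \<open>primitive_multiple\<close>, \<open>u\<close> is \<open>c\<close> times a
  vector that takes the value 1; primitivity leaves only \<open>c = 1\<close> and
  \<open>c = - 1\<close>, and the sign is moved to \<open>w\<close>.\<close>

lemma primitive_vec_witness: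
  assumes "primitive_vec n u"
  shows "\<exists>x\<in>real_vec ` I_lattice n. lorentz n (real_vec u) x = 1"
proof -
  let ?L = "real_vec ` I_lattice n"
  have u: "u \<in> I_lattice n" and np: "\<And>k v. k > 1 \<Longrightarrow> v \<in> I_lattice n \<Longrightarrow> u \<noteq> k \<cdot>\<^sub>v v"
    using assms by (auto simp: primitive_vec_def)
  have sm: "k \<cdot>\<^sub>v v \<in> I_lattice n" if "v \<in> I_lattice n" for k v
    using that by (simp add: I_lattice_def)
  have eq: "u = k \<cdot>\<^sub>v v" if "v \<in> I_lattice n" "real_vec u = of_int k *\<^sub>R real_vec v" for k v
    using inj_onD[OF real_vec_inj, of u "k \<cdot>\<^sub>v v" n] that u sm by (simp add: real_vec_smult)
  have z: "0\<^sub>v (Suc n) \<in> I_lattice n" "real_vec (0\<^sub>v (Suc n)) = 0"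
    by (auto simp: I_lattice_def real_vec_def fun_eq_iff)
  have "real_vec u \<noteq> 0"
    using np[of 2 "0\<^sub>v (Suc n)"] eq[OF z(1), of 2] z by auto
  moreover have "real_vec u \<in> ?L" using u by blast
  ultimately obtain c :: int and v w where v: "v \<in> I_lattice n" and w: "w \<in> ?L"
    and uc: "real_vec u = of_int c *\<^sub>R real_vec v" and vw: "lorentz n (real_vec v) w = 1"
    using lorentz.primitive_multiple[OF I_lattice_unimodular(1), of "real_vec u" n] by blast
  have "\<not> c > 1" using np[OF _ v] eq[OF v uc] by blast
  moreover have "\<not> c < - 1"
  proof
    assume c: "c < - 1"
    have "real_vec u = of_int (- c) *\<^sub>R real_vec ((- 1) \<cdot>\<^sub>v v)" using uc by (simp add: real_vec_smult)
    then have "u = (- c) \<cdot>\<^sub>v ((- 1) \<cdot>\<^sub>v v)" using eq[OF sm[OF v]] by blast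
    then show False using np[OF _ sm[OF v]] c by auto
  qed
  moreover have "c \<noteq> 0" using uc \<open>real_vec u \<noteq> 0\<close> by auto
  ultimately have "c = 1 \<or> c = - 1" by linarith
  then have "c * c = 1" by auto
  then have "of_int c * of_int c = (1::real)" by (metis of_int_1 of_int_mult)
  then have "lorentz n (real_vec u) (of_int c *\<^sub>R w) = 1" using uc vw by simp
  moreover have "of_int c *\<^sub>R w \<in> ?L"
    by (rule lorentz.uni_scale[OF I_lattice_unimodular(1) w]) simp
  ultimately show ?thesis by blast
qed

text \<open>The isometry is pulled back along the injection \<open>real_vec\<close>. Injectivity
  comes from nondegeneracy and integer linearity from additivity.\<close>

lemma pair_iso_automorphism:
  assumes u: "u \<in> I_lattice n" and v: "v \<in> I_lattice n"
    and iso: "lorentz.pair_iso n (real_vec ` I_lattice n) (real_vec u) (real_vec ` I_lattice n) (real_vec v)"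
  shows "\<exists>f\<in>I_automorphisms n. f u = v"
proof -
  let ?L = "I_lattice n"
  obtain \<phi> where im: "\<phi> ` real_vec ` ?L = real_vec ` ?L"
    and add: "\<And>x y. x \<in> real_vec ` ?L \<Longrightarrow> y \<in> real_vec ` ?L \<Longrightarrow> \<phi> (x + y) = \<phi> x + \<phi> y"
    and form: "\<And>x y. x \<in> real_vec ` ?L \<Longrightarrow> y \<in> real_vec ` ?L \<Longrightarrow> lorentz n (\<phi> x) (\<phi> y) = lorentz n x y"
    and uv: "\<phi> (real_vec u) = real_vec v"
    using iso unfolding lorentz.pair_iso_def by metis
  define f where "f = (\<lambda>x\<in>?L. inv_into ?L real_vec (\<phi> (real_vec x)))"
  have mem: "\<phi> (real_vec x) \<in> real_vec ` ?L" if "x \<in> ?L" for x using im that by blast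
  have fL: "f x \<in> ?L" if "x \<in> ?L" for x
    using inv_into_into[OF mem[OF that]] that by (simp add: f_def)
  have rf: "real_vec (f x) = \<phi> (real_vec x)" if "x \<in> ?L" for x
    using f_inv_into_f[OF mem[OF that]] that by (simp add: f_def)
  have eqI: "x = y" if "x \<in> ?L" "y \<in> ?L" "real_vec x = real_vec y" for x y
    using real_vec_inj that by (auto dest: inj_onD)
  have cl: "x + y \<in> ?L" "k \<cdot>\<^sub>v x \<in> ?L" if "x \<in> ?L" "y \<in> ?L" for x y k
    using that by (auto simp: I_lattice_def)
  have "inj_on f ?L"
  proof (rule inj_onI)
    fix x y assume xy: "x \<in> ?L" "y \<in> ?L" "f x = f y"
    then have eq: "\<phi> (real_vec x) = \<phi> (real_vec y)" using rf by metis
    have "real_vec x - real_vec y = 0"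
    proof (rule lorentz.uni_nondeg[OF I_lattice_unimodular(1)])
      show "real_vec x - real_vec y \<in> real_vec ` ?L"
        using xy by (intro lorentz.uni_diff[OF I_lattice_unimodular(1)]) auto
      fix w assume w: "w \<in> real_vec ` ?L"
      have "lorentz n (real_vec x) w = lorentz n (real_vec y) w"
        using form[OF _ w, of "real_vec x"] form[OF _ w, of "real_vec y"] xy eq by auto
      then show "lorentz n (real_vec x - real_vec y) w = 0" by simp
    qed
    then show "x = y" using eqI xy by simp
  qed
  moreover have "f ` ?L = ?L"
  proof (intro equalityI subsetI)
    fix y assume y: "y \<in> ?L"
    then have "real_vec y \<in> \<phi> ` real_vec ` ?L" using im by blast
    then obtain x where "x \<in> ?L" "real_vec y = \<phi> (real_vec x)" by blast
    then have "y = f x" using eqI[OF y fL] rf by simp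
    then show "y \<in> f ` ?L" using \<open>x \<in> ?L\<close> by blast
  qed (use fL in auto)
  ultimately have "f \<in> Bij ?L" by (auto simp: Bij_def bij_betw_def f_def)
  moreover have "f (x + y) = f x + f y" if "x \<in> ?L" "y \<in> ?L" for x y
    using eqI[OF fL[OF cl(1)] cl(1)[OF fL fL]] that
    by (simp add: rf cl real_vec_add[of _ n] fL add)
  moreover have "f (k \<cdot>\<^sub>v x) = k \<cdot>\<^sub>v f x" if x: "x \<in> ?L" for x k
  proof (rule eqI)
    have "\<phi> (of_int k *\<^sub>R real_vec x) = of_int k *\<^sub>R \<phi> (real_vec x)"
      using x by (intro lorentz.additive_int_scale[of _ "real_vec ` ?L"] add)
        (auto intro!: lorentz.uni_scale[OF I_lattice_unimodular(1)])
    then show "real_vec (f (k \<cdot>\<^sub>v x)) = real_vec (k \<cdot>\<^sub>v f x)"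
      using x cl by (simp add: rf real_vec_smult)
  qed (use x cl fL in auto)
  moreover have "I_form n (f x) (f y) = I_form n x y" if xy: "x \<in> ?L" "y \<in> ?L" for x y
  proof -
    have "(of_int (I_form n (f x) (f y)) :: real) = of_int (I_form n x y)"
      using xy by (simp add: lorentz_real_vec[symmetric] fL rf form)
    then show ?thesis by simp
  qed
  ultimately have "f \<in> I_automorphisms n" by (simp add: I_automorphisms_def)
  moreover have "f u = v" using eqI[OF fL[OF u] v] rf[OF u] uv by simp
  ultimately show ?thesis by blast
qed

text \<open>If \<open>u $ i\<close> is odd, then \<open>(u $ i - x $ i) * x $ i\<close> is even for
  every \<open>x\<close>.\<close>

lemma characteristic_vec_if_odd:
  assumes "u \<in> I_lattice n" "\<And>i. i \<le> n \<Longrightarrow> odd (u $ i)"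
  shows "characteristic_vec n u"
  unfolding characteristic_vec_def
proof (intro conjI ballI assms(1))
  fix x assume "x \<in> I_lattice n"
  have "I_form n u x - I_form n x x = (u $ 0 - x $ 0) * x $ 0 - (\<Sum>i = 1..n. (u $ i - x $ i) * x $ i)"
    by (simp add: I_form_def algebra_simps sum_subtractf)
  moreover have "even ((u $ i - x $ i) * x $ i)" if "i \<le> n" for i using assms(2)[OF that] by auto
  then have "even ((u $ 0 - x $ 0) * x $ 0 - (\<Sum>i = 1..n. (u $ i - x $ i) * x $ i))"
    by (intro dvd_diff dvd_sum) auto
  ultimately show "[I_form n u x = I_form n x x] (mod 2)" by (simp add: cong_iff_dvd_diff)
qed

text \<open>The witness (2k+1; 2k-1, 1, ..., 1) has norm 8k - (n-1). All entries are odd, and the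
  entry 1 at index 2, present because \<open>n\<close> is at least 2, makes it primitive.\<close>

lemma primitive_characteristic_vec_exists:
  assumes n: "n \<ge> 2" and k: "m = int n - 1 - 8 * k"
  shows "\<exists>u. primitive_vec n u \<and> characteristic_vec n u \<and> I_norm n u = - m"
proof -
  define u where "u = vec (Suc n) (\<lambda>i. if i = 0 then 2 * k + 1 else if i = 1 then 2 * k - 1 else 1)"
  have u: "u \<in> I_lattice n" by (simp add: u_def I_lattice_def)
  have "characteristic_vec n u"
    by (rule characteristic_vec_if_odd[OF u]) (auto simp: u_def)
  moreover have "primitive_vec n u"
    unfolding primitive_vec_def
  proof (intro conjI u notI)
    assume "\<exists>l>1. u \<in> (\<cdot>\<^sub>v) l ` I_lattice n"
    then obtain l v where l: "l > 1" "v \<in> I_lattice n" "u = l \<cdot>\<^sub>v v" by blast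
    have "u $ 2 = 1" using n by (simp add: u_def)
    moreover have "u $ 2 = l * v $ 2" using l n by (simp add: I_lattice_def)
    ultimately show False using l(1) by (simp add: zmult_eq_1_iff)
  qed
  moreover have "I_norm n u = - m"
  proof -
    have "(\<Sum>i = 1..n. u $ i * u $ i) = u $ 1 * u $ 1 + (\<Sum>i = 2..n. u $ i * u $ i)"
      using n by (subst sum.atLeast_Suc_atMost) (auto simp: numeral_2_eq_2)
    also have "(\<Sum>i = 2..n. u $ i * u $ i) = (\<Sum>i = 2..n. 1)"
      by (intro sum.cong) (auto simp: u_def)
    finally have "(\<Sum>i = 1..n. u $ i * u $ i) = (2 * k - 1) * (2 * k - 1) + (int n - 1)"
      using n by (simp add: u_def of_nat_diff)
    then show ?thesis by (simp add: I_norm_def I_form_def k) (simp add: u_def algebra_simps)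
  qed
  ultimately show ?thesis by blast
qed

theorem theorem4:
  fixes n :: nat and m :: int
  assumes "n \<ge> 3" and "1 \<le> m" and "m < int n" and "[m = int n - 1] (mod 8)"
  defines "S \<equiv> {u \<in> I_lattice n. primitive_vec n u \<and> characteristic_vec n u \<and> I_norm n u = - m}"
  shows "S \<noteq> {} \<and> S \<in> orbits (Aut_I n) (I_lattice n) (\<lambda>f. f)"
proof -
  \<comment> \<open>The congruence supplies the parameter of the explicit vector.\<close>
  obtain k where k: "int n - 1 = m + 8 * k" using assms(4) by (auto simp: cong_iff_lin)
  then have "m = int n - 1 - 8 * k" by simp
  then obtain u where "primitive_vec n u" "characteristic_vec n u" "I_norm n u = - m"
    using primitive_characteristic_vec_exists[of n m k] assms(1) by auto
  then have uS: "u \<in> S" by (simp add: S_def primitive_vec_def)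
  have adm: "lorentz.admissible n n (nat m) (real_vec ` I_lattice n) (real_vec v)" if "v \<in> S" for v
  proof -
    have v: "v \<in> I_lattice n" "primitive_vec n v" "characteristic_vec n v" "I_form n v v = - m"
      using that by (auto simp: S_def I_norm_def)
    then have "lorentz n (real_vec v) (real_vec v) = - real (nat m)"
      using assms(2) by (simp add: lorentz_real_vec)
    then show ?thesis
      unfolding lorentz.admissible_def
      using I_lattice_unimodular primitive_vec_witness[OF v(2)] characteristic_vec_iff[OF v(1)] v(3)
      by blast
  qed
  have "S = orbit (Aut_I n) (\<lambda>f. f) u"
  proof (intro equalityI subsetI)
    fix v assume v: "v \<in> S"
    have "lorentz.pair_iso n (real_vec ` I_lattice n) (real_vec u) (real_vec ` I_lattice n) (real_vec v)"
      by (rule lorentz.admissible_pair_iso[OF _ _ adm[OF uS] adm[OF v]]) (use assms(2,3) in auto)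
    then obtain f where "f \<in> I_automorphisms n" "f u = v"
      using pair_iso_automorphism[of u n v] uS v by (auto simp: S_def)
    then show "v \<in> orbit (Aut_I n) (\<lambda>f. f) u" by (auto simp: orbit_def Aut_I_def)
  next
    \<comment> \<open>Conversely, automorphisms preserve the conditions in \<open>S\<close>:
      surjectivity lets a divisor of \<open>f u\<close>, or a test vector, be pulled back.\<close>
    fix v assume "v \<in> orbit (Aut_I n) (\<lambda>f. f) u"
    then obtain f where f: "f \<in> I_automorphisms n" and v: "v = f u" by (auto simp: orbit_def Aut_I_def)
    have bij: "bij_betw f (I_lattice n) (I_lattice n)" using f by (auto simp: I_automorphisms_def Bij_def)
    have sm: "\<And>k x. x \<in> I_lattice n \<Longrightarrow> f (k \<cdot>\<^sub>v x) = k \<cdot>\<^sub>v f x"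
      and form: "\<And>x y. x \<in> I_lattice n \<Longrightarrow> y \<in> I_lattice n \<Longrightarrow> I_form n (f x) (f y) = I_form n x y"
      using f by (auto simp: I_automorphisms_def)
    have pre: "\<exists>y\<in>I_lattice n. x = f y" if "x \<in> I_lattice n" for x
      using bij that by (auto simp: bij_betw_def)
    have u: "u \<in> I_lattice n" "primitive_vec n u" "characteristic_vec n u" "I_norm n u = - m"
      using uS by (auto simp: S_def)
    have vL: "v \<in> I_lattice n" using bij u(1) v by (auto simp: bij_betw_def)
    have "primitive_vec n v"
      unfolding primitive_vec_def
    proof (intro conjI vL notI)
      assume "\<exists>l>1. v \<in> (\<cdot>\<^sub>v) l ` I_lattice n"
      then obtain l x where l: "l > 1" "x \<in> I_lattice n" "v = l \<cdot>\<^sub>v x" by blast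
      obtain y where y: "y \<in> I_lattice n" "x = f y" using pre[OF l(2)] by blast
      have "f u = f (l \<cdot>\<^sub>v y)" using l v y sm by simp
      moreover have "l \<cdot>\<^sub>v y \<in> I_lattice n" using y(1) by (simp add: I_lattice_def)
      ultimately have "u = l \<cdot>\<^sub>v y" using bij u(1) by (auto simp: bij_betw_def dest: inj_onD)
      then show False using u(2) l(1) y(1) by (auto simp: primitive_vec_def)
    qed
    moreover have "characteristic_vec n v"
      unfolding characteristic_vec_def
    proof (intro conjI vL ballI)
      fix x assume "x \<in> I_lattice n"
      then obtain y where y: "y \<in> I_lattice n" "x = f y" using pre by blast
      show "[I_form n v x = I_form n x x] (mod 2)"
        using u(3) y u(1) by (simp add: v form characteristic_vec_def)
    qed
    moreover have "I_norm n v = - m" using u form[OF u(1) u(1)] by (simp add: I_norm_def v)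
    ultimately show "v \<in> S" using vL by (simp add: S_def)
  qed
  then have "S \<in> orbits (Aut_I n) (I_lattice n) (\<lambda>f. f)"
    unfolding orbits_def using uS by (auto simp: S_def)
  then show ?thesis using uS by blast
qed

end
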